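(* Let $n\ge1$ be a natural number and let $\mu$ be a finite measure on $\mathcal{T}=[0,1]$ with $\mu(\mathcal{T})>0$. For every $\delta>0$, every sequential $\delta$-better-response dynamic in the producer game with fine preferences $(n,\mu,\succeq_F)$ reaches a Nash equilibrium of $(n,\mu,\succeq_F)$ in a finite number of steps, and remains constant from that point onward.
   Context: Notation: $\mathcal{T}=[0,1]$ (with the Borel $\sigma$-algebra), $\mathbb{P}_n=\{0,1,\ldots,n-1\}$, and $(\bar t_{-j},t')$ denotes $\bar t$ with its $j$-th coordinate replaced by $t'$. Consumer game $(\mu;\bar t)$, for $\bar t=(t_0,\ldots,t_{n-1})\in\mathcal{T}^{\mathbb{P}_n}$. Consumers of types $d\in\mathcal{T}$ are distributed according to $\mu$. The strategies of type $d$ are $S_d=\{j\in\mathbb{P}_n\mid t_j\le d\}\cup\{\lnot\}$ ($\lnot$ means "not consuming"); $S=\mathbb{P}_n\cup\{\lnot\}$. A mixed-consumption profile is a measurable $s:\mathcal{T}\to[0,1]^S$ such that, for every $d$, $s(d)$ is a probability vector on $S$ supported in $S_d$; its loads are $\ell^s_j=\int_{\mathcal{T}}s_j\,d\mu$. It is a Nash equilibrium if for every $d\in\mathcal{T}$: $\lnot\in\operatorname{supp}(s(d))$ only if $S_d=\{\lnot\}$, and $\ell^s_k\le\ell^s_j$ for all $k\in\operatorname{supp}(s(d))$, $j\in S_d\setminus\{\lnot\}$. Such equilibria exist and all have the same producer loads; $\ell_j(\bar t)$ denotes the load $\ell^s_j$ of producer $j\in\mathbb{P}_n$ in any such equilibrium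 $s$. Producer game with fine preferences $(n,\mu,\succeq_F)$: the players are the producers $\mathbb{P}_n$, each with pure-strategy set $\mathcal{T}$. Producer $j$ strictly prefers profile $\bar t$ to profile $\bar t'$ iff $\ell_j(\bar t)>\ell_j(\bar t')$, or $\ell_j(\bar t)=\ell_j(\bar t')$ and $t_j>t'_j$. A schedule is a sequence $(P_i)_{i=0}^\infty$ of nonempty subsets of $\mathbb{P}_n$ such that every $j\in\mathbb{P}_n$ belongs to infinitely many $P_i$; it is sequential if $|P_i|=1$ for all $i$. A weakly-better-response dynamic is a sequence $(\bar t^i,P_i)_{i=0}^\infty$, with $(P_i)$ a schedule and $\bar t^i\in\mathcal{T}^{\mathbb{P}_n}$, such that for every $i$: for $j\in P_i$, producer $j$ weakly prefers $(\bar t^i_{-j},t^{i+1}_j)$ to $\bar t^i$; for $j\notin P_i$, $t^{i+1}_j=t^i_j$. It is a $\delta$-better-response dynamic if moreover for every $i$ and $j\in P_i$, either $t^{i+1}_j$ is a best response of $j$ to $\bar t^i_{-j}$ (with respect to fine preferences) or $\ell_j(\bar t^i_{-j},t^{i+1}_j)\ge\ell_j(\bar t^i)+\delta$. It is called sequential if its schedule is. *)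

theory Defs
  imports "HOL-Analysis.Analysis"
begin

definition types :: "real set" ("\<T>") where
  "\<T> = {0..1}"

definition producers :: "nat \<Rightarrow> nat set" ("\<P>") where
  "\<P> n = {..<n}"

text \<open>
  Elements of \<open>\<T>\<close> to the power \<open>\<P> n\<close> are extensional functions, so that equality of profiles
  is equality in HOL and the replacement of coordinate \<open>j\<close> by \<open>t'\<close> is \<open>t(j := t')\<close>.
\<close>

definition profiles :: "nat \<Rightarrow> (nat \<Rightarrow> real) set" where
  "profiles n = \<P> n \<rightarrow>\<^sub>E \<T>"

definition measure_on_types :: "real measure \<Rightarrow> bool" where
  "measure_on_types \<mu> \<longleftrightarrow> sets \<mu> = sets (restrict_space borel \<T>)"


section \<open>The consumer game\<close>

text \<open>\<open>Some j\<close> is consuming from producer \<open>j\<close>; \<open>None\<close> is not consuming.\<close>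

definition strategies :: "nat \<Rightarrow> nat option set" where
  "strategies n = insert None (Some ` \<P> n)"

definition strategies_of :: "nat \<Rightarrow> (nat \<Rightarrow> real) \<Rightarrow> real \<Rightarrow> nat option set" where
  "strategies_of n t d = insert None (Some ` {j \<in> \<P> n. t j \<le> d})"

definition support :: "nat \<Rightarrow> (nat option \<Rightarrow> real) \<Rightarrow> nat option set" where
  "support n p = {a \<in> strategies n. p a \<noteq> 0}"

text \<open>The range \<open>[0,1]\<close> of the coordinates is part of the measurability condition.\<close>

definition mixed_consumption ::
    "nat \<Rightarrow> real measure \<Rightarrow> (nat \<Rightarrow> real) \<Rightarrow> (real \<Rightarrow> nat option \<Rightarrow> real) \<Rightarrow> bool" where
  "mixed_consumption n \<mu> t s \<longleftrightarrow>
     s \<in> measurable \<mu> (PiM (strategies n) (\<lambda>_. restrict_space borel {0..1})) \<and>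
     (\<forall>d\<in>\<T>. (\<Sum>a\<in>strategies n. s d a) = 1 \<and> support n (s d) \<subseteq> strategies_of n t d)"

definition profile_load :: "real measure \<Rightarrow> (real \<Rightarrow> nat option \<Rightarrow> real) \<Rightarrow> nat \<Rightarrow> real" where
  "profile_load \<mu> s j = (LINT d|\<mu>. s d (Some j))"

definition consumer_equilibrium ::
    "nat \<Rightarrow> real measure \<Rightarrow> (nat \<Rightarrow> real) \<Rightarrow> (real \<Rightarrow> nat option \<Rightarrow> real) \<Rightarrow> bool" where
  "consumer_equilibrium n \<mu> t s \<longleftrightarrow>
     mixed_consumption n \<mu> t s \<and>
     (\<forall>d\<in>\<T>. (None \<in> support n (s d) \<longrightarrow> strategies_of n t d = {None}) \<and>
        (\<forall>k j. Some k \<in> support n (s d) \<longrightarrow> Some j \<in> strategies_of n t d \<longrightarrow>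
           profile_load \<mu> s k \<le> profile_load \<mu> s j))"

text \<open>
  Consumer equilibria exist and all have the same producer loads, so the description below
  denotes the common load of \<open>j\<close>.
\<close>

definition load :: "nat \<Rightarrow> real measure \<Rightarrow> (nat \<Rightarrow> real) \<Rightarrow> nat \<Rightarrow> real" where
  "load n \<mu> t j = (THE x. \<exists>s. consumer_equilibrium n \<mu> t s \<and> profile_load \<mu> s j = x)"


section \<open>The producer game with fine preferences\<close>

definition strictly_prefers ::
    "nat \<Rightarrow> real measure \<Rightarrow> nat \<Rightarrow> (nat \<Rightarrow> real) \<Rightarrow> (nat \<Rightarrow> real) \<Rightarrow> bool" where
  "strictly_prefers n \<mu> j t t' \<longleftrightarrow>
     load n \<mu> t j > load n \<mu> t' j \<or> (load n \<mu> t j = load n \<mu> t' j \<and> t j > t' j)"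

definition weakly_prefers ::
    "nat \<Rightarrow> real measure \<Rightarrow> nat \<Rightarrow> (nat \<Rightarrow> real) \<Rightarrow> (nat \<Rightarrow> real) \<Rightarrow> bool" where
  "weakly_prefers n \<mu> j t t' \<longleftrightarrow> \<not> strictly_prefers n \<mu> j t' t"

text \<open>\<open>x\<close> is a best response of \<open>j\<close> to \<open>t\<close> without its coordinate \<open>j\<close>; the value \<open>t j\<close> is immaterial.\<close>

definition best_response :: "nat \<Rightarrow> real measure \<Rightarrow> nat \<Rightarrow> (nat \<Rightarrow> real) \<Rightarrow> real \<Rightarrow> bool" where
  "best_response n \<mu> j t x \<longleftrightarrow>
     x \<in> \<T> \<and> (\<forall>y\<in>\<T>. weakly_prefers n \<mu> j (t(j := x)) (t(j := y)))"

definition producer_equilibrium :: "nat \<Rightarrow> real measure \<Rightarrow> (nat \<Rightarrow> real) \<Rightarrow> bool" where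
  "producer_equilibrium n \<mu> t \<longleftrightarrow>
     t \<in> profiles n \<and> (\<forall>j\<in>\<P> n. \<forall>y\<in>\<T>. \<not> strictly_prefers n \<mu> j (t(j := y)) t)"


section \<open>Dynamics\<close>

definition schedule :: "nat \<Rightarrow> (nat \<Rightarrow> nat set) \<Rightarrow> bool" where
  "schedule n P \<longleftrightarrow>
     (\<forall>i. P i \<noteq> {} \<and> P i \<subseteq> \<P> n) \<and> (\<forall>j\<in>\<P> n. infinite {i. j \<in> P i})"

definition sequential :: "(nat \<Rightarrow> nat set) \<Rightarrow> bool" where
  "sequential P \<longleftrightarrow> (\<forall>i. card (P i) = 1)"

definition weakly_better_response_dynamic ::
    "nat \<Rightarrow> real measure \<Rightarrow> (nat \<Rightarrow> nat \<Rightarrow> real) \<Rightarrow> (nat \<Rightarrow> nat set) \<Rightarrow> bool" where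
  "weakly_better_response_dynamic n \<mu> t P \<longleftrightarrow>
     schedule n P \<and> (\<forall>i. t i \<in> profiles n) \<and>
     (\<forall>i. (\<forall>j\<in>P i. weakly_prefers n \<mu> j ((t i)(j := t (Suc i) j)) (t i)) \<and>
          (\<forall>j\<in>\<P> n - P i. t (Suc i) j = t i j))"

definition better_response_dynamic ::
    "real \<Rightarrow> nat \<Rightarrow> real measure \<Rightarrow> (nat \<Rightarrow> nat \<Rightarrow> real) \<Rightarrow> (nat \<Rightarrow> nat set) \<Rightarrow> bool" where
  "better_response_dynamic \<delta> n \<mu> t P \<longleftrightarrow>
     weakly_better_response_dynamic n \<mu> t P \<and>
     (\<forall>i. \<forall>j\<in>P i. best_response n \<mu> j (t i) (t (Suc i) j) \<or>
        load n \<mu> ((t i)(j := t (Suc i) j)) j \<ge> load n \<mu> (t i) j + \<delta>)"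

end

theory Submission
  imports Defs
begin

text \<open>
  Write \<open>R y\<close> for the mass of the types \<open>\<ge> y\<close>. In a consumer equilibrium the sum of the truncated
  loads \<open>min \<ell>\<^sub>k c\<close> is the minimum over \<open>y\<close> of \<open>c \<cdot> #{k. t\<^sub>k < y} + R y\<close>, hence it grows when thresholds
  decrease. A producer's own load decreases in its threshold, and if raising the threshold leaves its
  own load unchanged, it leaves all loads unchanged. So a step either raises the threshold and
  preserves all loads, or lowers the threshold and raises all truncated sums; in the latter case a
  gain of \<open>\<delta>\<close> raises one of finitely many truncated sums by \<open>\<delta> / 4\<close>, so there are finitely many such
  gains. Afterwards all steps are best responses. Comparison with the threshold 0 shows that a best
  response makes the load of the moving producer maximal and lets all consumers be served; then each
  strict gain of load increases the number of producers of maximal load. Eventually the loads are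
  constant, hence all equal, and thresholds only move up. A producer that has given a best response
  never moves again: a higher threshold that keeps the loads equal later would have kept them equal
  already then, since the other thresholds were lower.
\<close>

section \<open>Balanced loads\<close>

text \<open>
  With \<open>R y\<close> the mass of the types \<open>\<ge> y\<close>, this characterises the loads \<open>l\<close> of a consumer equilibrium
  without mentioning consumers: producers with threshold \<open>\<ge> y\<close> can only be used by types \<open>\<ge> y\<close>,
  and the producers with load \<open>\<le> c\<close> absorb every type that has access to one of them.
\<close>

definition balanced :: "'a set \<Rightarrow> (real \<Rightarrow> real) \<Rightarrow> ('a \<Rightarrow> real) \<Rightarrow> ('a \<Rightarrow> real) \<Rightarrow> bool" where
  "balanced A R t l \<longleftrightarrow>
     (\<forall>k\<in>A. 0 \<le> l k) \<and>
     (\<forall>y. (\<Sum>k | k \<in> A \<and> y \<le> t k. l k) \<le> R y) \<and>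
     (\<forall>c. \<exists>y. {k \<in> A. l k \<le> c} = {k \<in> A. y \<le> t k} \<and> (\<Sum>k | k \<in> A \<and> l k \<le> c. l k) = R y)"

lemma Collect_conj_eqD: "{k \<in> A. p k} = {k \<in> A. q k} \<Longrightarrow> k \<in> A \<Longrightarrow> p k \<longleftrightarrow> q k"
  by blast

lemma balanced_nonneg: "balanced A R t l \<Longrightarrow> k \<in> A \<Longrightarrow> 0 \<le> l k"
  by (auto simp: balanced_def)

lemma balanced_sum_le: "balanced A R t l \<Longrightarrow> (\<Sum>k | k \<in> A \<and> y \<le> t k. l k) \<le> R y"
  by (auto simp: balanced_def)

lemma balanced_level:
  assumes "balanced A R t l"
  obtains y where "{k \<in> A. l k \<le> c} = {k \<in> A. y \<le> t k}" "(\<Sum>k | k \<in> A \<and> l k \<le> c. l k) = R y"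
  using assms unfolding balanced_def by blast

lemma balanced_strict_level:
  assumes "finite A" "balanced A R t l"
  obtains y where "{k \<in> A. l k < c} = {k \<in> A. y \<le> t k}" "(\<Sum>k | k \<in> A \<and> l k < c. l k) = R y"
proof -
  define B where "B = {k \<in> A. l k < c}"
  \<comment> \<open>Strict sublevel sets reduce to weak ones at the largest load below
    \<open>c\<close>; if there is none, -1 lies below all loads and cuts out the empty set.\<close>
  define b where "b = (if B = {} then -1 else Max (l ` B))"
  have "finite B" using assms by (simp add: B_def)
  have eq: "{k \<in> A. l k < c} = {k \<in> A. l k \<le> b}"
  proof (cases "B = {}")
    case True
    then show ?thesis
      using balanced_nonneg[OF assms(2)] by (force simp: b_def B_def)
  next
    case False
    then have "b \<in> l ` B" using \<open>finite B\<close> by (simp add: b_def)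
    moreover have "l k \<le> b" if "k \<in> B" for k
      using that False \<open>finite B\<close> by (simp add: b_def)
    ultimately show ?thesis unfolding B_def by force
  qed
  obtain y where "{k \<in> A. l k \<le> b} = {k \<in> A. y \<le> t k}" "(\<Sum>k | k \<in> A \<and> l k \<le> b. l k) = R y"
    using balanced_level[OF assms(2)] .
  then show ?thesis using that eq by simp
qed

lemma balanced_antimono:
  assumes "balanced A R t l" "j \<in> A" "k \<in> A" "t j \<le> t k"
  shows "l k \<le> l j"
proof -
  obtain y where y: "{k \<in> A. l k \<le> l j} = {k \<in> A. y \<le> t k}"
    using balanced_level[OF assms(1)] .
  show ?thesis
    using Collect_conj_eqD[OF y assms(2)] Collect_conj_eqD[OF y assms(3)] assms(4) by simp
qed

lemma sum_split_threshold:
  fixes f :: "'a \<Rightarrow> real" and t :: "'a \<Rightarrow> real"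
  assumes "finite A"
  shows "sum f A = (\<Sum>k | k \<in> A \<and> t k < y. f k) + (\<Sum>k | k \<in> A \<and> y \<le> t k. f k)"
proof -
  have "A = {k \<in> A. t k < y} \<union> {k \<in> A. y \<le> t k}" by auto
  then show ?thesis
    using assms by (subst (1) \<open>A = _\<close>, subst sum.union_disjoint) auto
qed

text \<open>Max-flow min-cut: \<open>\<Sum>k\<in>A. min (l k) c\<close> is the minimum over \<open>y\<close> of the bounds below.\<close>

lemma balanced_cut_le:
  assumes "finite A" "balanced A R t l"
  shows "(\<Sum>k\<in>A. min (l k) c) \<le> c * card {k \<in> A. t k < y} + R y"
proof -
  have "(\<Sum>k | k \<in> A \<and> t k < y. min (l k) c) \<le> (\<Sum>k | k \<in> A \<and> t k < y. c)"
    by (rule sum_mono) simp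
  moreover have "(\<Sum>k | k \<in> A \<and> y \<le> t k. min (l k) c) \<le> (\<Sum>k | k \<in> A \<and> y \<le> t k. l k)"
    by (rule sum_mono) simp
  ultimately show ?thesis
    using balanced_sum_le[OF assms(2), of y] sum_split_threshold[OF assms(1), of "\<lambda>k. min (l k) c" t y]
    by (simp add: mult.commute)
qed

text \<open>A producer below the cut contributes \<open>c\<close> and one above it its load. At load
  exactly \<open>c\<close> the two agree, which is why strict sublevel sets do as well.\<close>

lemma sum_min_level:
  fixes l t :: "'a \<Rightarrow> real" and c y :: real
  assumes "finite A" "{k \<in> A. l k \<le> c} = {k \<in> A. y \<le> t k} \<or> {k \<in> A. l k < c} = {k \<in> A. y \<le> t k}"
  shows "(\<Sum>k\<in>A. min (l k) c) = c * card {k \<in> A. t k < y} + (\<Sum>k | k \<in> A \<and> y \<le> t k. l k)"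
proof -
  have "(\<Sum>k | k \<in> A \<and> t k < y. min (l k) c) = (\<Sum>k | k \<in> A \<and> t k < y. c)"
    using assms(2) by (intro sum.cong) force+
  moreover have "(\<Sum>k | k \<in> A \<and> y \<le> t k. min (l k) c) = (\<Sum>k | k \<in> A \<and> y \<le> t k. l k)"
    using assms(2) by (intro sum.cong) force+
  ultimately show ?thesis
    using sum_split_threshold[OF assms(1), of "\<lambda>k. min (l k) c" t y]
    by (simp add: mult.commute)
qed

text \<open>The sublevel set at \<open>c\<close> saturates its types, so the cut bound is attained
  there.\<close>

lemma balanced_cut:
  assumes "finite A" "balanced A R t l"
  obtains y where "{k \<in> A. l k \<le> c} = {k \<in> A. y \<le> t k}"
    "(\<Sum>k\<in>A. min (l k) c) = c * card {k \<in> A. t k < y} + R y"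
proof -
  obtain y where y: "{k \<in> A. l k \<le> c} = {k \<in> A. y \<le> t k}" "(\<Sum>k | k \<in> A \<and> l k \<le> c. l k) = R y"
    using balanced_level[OF assms(2)] .
  show ?thesis
    using that[OF y(1)] sum_min_level[of A l c y t] assms(1) y by auto
qed

section \<open>Comparison of the loads of two profiles\<close>

lemma level_sets_eq:
  fixes l l' :: "'a \<Rightarrow> real"
  assumes "finite A"
    and "(\<Sum>k | k \<in> A \<and> l k \<le> c. l' k) \<le> (\<Sum>k | k \<in> A \<and> l k \<le> c. l k)"
    and "(\<Sum>k | k \<in> A \<and> l' k \<le> c. l k) \<le> (\<Sum>k | k \<in> A \<and> l' k \<le> c. l' k)"
  shows "{k \<in> A. l k \<le> c} = {k \<in> A. l' k \<le> c}"
proof -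
  let ?B = "{k \<in> A. l k \<le> c}" and ?C = "{k \<in> A. l' k \<le> c}"
  have split: "sum f ?B = sum f (?B \<inter> ?C) + sum f (?B - ?C)"
       "sum f ?C = sum f (?B \<inter> ?C) + sum f (?C - ?B)" for f :: "'a \<Rightarrow> real"
    using assms(1) by (simp_all add: sum.Int_Diff[of ?B _ ?C] sum.Int_Diff[of ?C _ ?B] Int_commute)
  \<comment> \<open>The two hypotheses add up to this. On \<open>?B - ?C\<close> one has
    \<open>l k \<le> c < l' k\<close>, on \<open>?C - ?B\<close> the reverse, so all summands are
    positive.\<close>
  have "(\<Sum>k\<in>?B - ?C. l' k - l k) + (\<Sum>k\<in>?C - ?B. l k - l' k) \<le> 0"
    using assms(2,3) split[of l] split[of l'] by (simp add: sum_subtractf)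
  moreover have "0 \<le> (\<Sum>k\<in>?B - ?C. l' k - l k)" "0 \<le> (\<Sum>k\<in>?C - ?B. l k - l' k)"
    by (auto intro!: sum_nonneg)
  moreover have "0 < (\<Sum>k\<in>?B - ?C. l' k - l k)" if "?B - ?C \<noteq> {}"
    using assms(1) that by (intro sum_pos) auto
  moreover have "0 < (\<Sum>k\<in>?C - ?B. l k - l' k)" if "?C - ?B \<noteq> {}"
    using assms(1) that by (intro sum_pos) auto
  ultimately have "?B - ?C = {}" "?C - ?B = {}" by linarith+
  then show ?thesis by blast
qed

text \<open>The sublevel set of \<open>l'\<close> uses up all of \<open>R y\<close>. Under the
  higher thresholds \<open>t\<close> its members still lie above \<open>y\<close>, where the total
  load cannot exceed \<open>R y\<close>.\<close>

lemma balanced_lower_level_sum: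
  assumes "finite A" "balanced A R t l" "balanced A R t' l'" "\<And>k. k \<in> A \<Longrightarrow> t' k \<le> t k"
  shows "(\<Sum>k | k \<in> A \<and> l' k \<le> c. l k) \<le> (\<Sum>k | k \<in> A \<and> l' k \<le> c. l' k)"
proof -
  obtain y where y: "{k \<in> A. l' k \<le> c} = {k \<in> A. y \<le> t' k}"
    "(\<Sum>k | k \<in> A \<and> l' k \<le> c. l' k) = R y"
    using balanced_level[OF assms(3)] .
  have "(\<Sum>k | k \<in> A \<and> l' k \<le> c. l k) \<le> (\<Sum>k | k \<in> A \<and> y \<le> t k. l k)"
    unfolding y(1) using assms(1,4) balanced_nonneg[OF assms(2)]
    by (intro sum_mono2) (auto intro: order_trans)
  also have "\<dots> \<le> R y" using balanced_sum_le[OF assms(2)] .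
  finally show ?thesis using y by simp
qed

lemma balanced_unique:
  assumes "finite A" "balanced A R t l" "balanced A R t l'" "k \<in> A"
  shows "l k = l' k"
proof -
  have "{k \<in> A. l k \<le> c} = {k \<in> A. l' k \<le> c}" for c
    by (rule level_sets_eq[OF assms(1) balanced_lower_level_sum[OF assms(1,3,2)]
          balanced_lower_level_sum[OF assms(1,2,3)]]) simp_all
  then have "l k \<le> c \<longleftrightarrow> l' k \<le> c" for c using assms(4) by blast
  then show ?thesis by (metis order_antisym order_refl)
qed

text \<open>If the load of \<open>j\<close> fell, the sublevel set of \<open>l\<close> at
  \<open>l' j\<close> would lie above a cut beyond \<open>t j\<close>. Moving \<open>j\<close>
  downwards leaves that cut alone, so both sublevel sets at \<open>l' j\<close> would agree,
  although only one contains \<open>j\<close>.\<close>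

lemma balanced_own_antimono:
  assumes "finite A" "balanced A R t l" "balanced A R (t(j := x)) l'" "j \<in> A" "x \<le> t j"
  shows "l j \<le> l' j"
proof (rule ccontr)
  assume "\<not> l j \<le> l' j"
  then have less: "l' j < l j" by simp
  obtain y where y: "{k \<in> A. l k \<le> l' j} = {k \<in> A. y \<le> t k}"
    "(\<Sum>k | k \<in> A \<and> l k \<le> l' j. l k) = R y"
    using balanced_level[OF assms(2)] .
  have "t j < y" using Collect_conj_eqD[OF y(1) assms(4)] less by simp
  then have "{k \<in> A. l k \<le> l' j} = {k \<in> A. y \<le> (t(j := x)) k}"
    using y(1) assms(5) by auto
  then have "(\<Sum>k | k \<in> A \<and> l k \<le> l' j. l' k) \<le> (\<Sum>k | k \<in> A \<and> l k \<le> l' j. l k)"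
    using y(2) balanced_sum_le[OF assms(3), of y] by simp
  moreover have "(\<Sum>k | k \<in> A \<and> l' k \<le> l' j. l k) \<le> (\<Sum>k | k \<in> A \<and> l' k \<le> l' j. l' k)"
    using assms(5) by (intro balanced_lower_level_sum[OF assms(1,2,3)]) simp
  ultimately have "{k \<in> A. l k \<le> l' j} = {k \<in> A. l' k \<le> l' j}"
    using assms(1) by (intro level_sets_eq)
  from Collect_conj_eqD[OF this assms(4)] show False using less by simp
qed

text \<open>At level \<open>l j\<close>, the minimum cut \<open>z\<close> of the new profile has
  \<open>j\<close> above it and so selects the same producers in both profiles. Comparison with a
  cut \<open>w\<close> that has \<open>j\<close> below it shows that \<open>z\<close> is minimal for
  the old profile too; its upper side is then saturated by loads at most \<open>l j\<close>.\<close>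

lemma balanced_same_own_load:
  assumes "finite A" "balanced A R t l" "balanced A R (t(j := x)) l'" "j \<in> A" "x \<le> t j"
    and same: "l' j = l j" and "k \<in> A"
  shows "l k = l' k"
proof -
  let ?t' = "t(j := x)"
  obtain z where z: "{k \<in> A. l' k \<le> l j} = {k \<in> A. z \<le> ?t' k}"
    "(\<Sum>k\<in>A. min (l' k) (l j)) = l j * card {k \<in> A. ?t' k < z} + R z"
    using balanced_cut[OF assms(1,3)] .
  have zx: "z \<le> x" using Collect_conj_eqD[OF z(1) assms(4)] same by simp
  have zt: "{k \<in> A. z \<le> ?t' k} = {k \<in> A. z \<le> t k}" "{k \<in> A. ?t' k < z} = {k \<in> A. t k < z}"
    using zx assms(5) by auto
  obtain w where w: "{k \<in> A. l k < l j} = {k \<in> A. w \<le> t k}"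
    "(\<Sum>k | k \<in> A \<and> l k < l j. l k) = R w"
    using balanced_strict_level[OF assms(1,2)] .
  have "t j < w" using Collect_conj_eqD[OF w(1) assms(4)] by simp
  then have wt: "{k \<in> A. ?t' k < w} = {k \<in> A. t k < w}" using assms(5) by auto
  have "(\<Sum>k\<in>A. min (l k) (l j)) = l j * card {k \<in> A. t k < w} + R w"
    using sum_min_level[of A l "l j" w t] assms(1) w by auto
  also have "\<dots> \<ge> (\<Sum>k\<in>A. min (l' k) (l j))"
    using balanced_cut_le[OF assms(1,3), of "l j" w] wt by simp
  finally have "l j * card {k \<in> A. t k < z} + R z \<le> (\<Sum>k\<in>A. min (l k) (l j))"
    using z(2) zt by simp
  also have "\<dots> \<le> l j * card {k \<in> A. t k < z} + (\<Sum>k | k \<in> A \<and> z \<le> t k. min (l k) (l j))"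
  proof -
    have "(\<Sum>k | k \<in> A \<and> t k < z. min (l k) (l j)) \<le> (\<Sum>k | k \<in> A \<and> t k < z. l j)"
      by (rule sum_mono) simp
    then show ?thesis
      using sum_split_threshold[OF assms(1), of "\<lambda>k. min (l k) (l j)" t z] by (simp add: mult.commute)
  qed
  finally have Rz: "R z \<le> (\<Sum>k | k \<in> A \<and> z \<le> t k. min (l k) (l j))" by simp
  \<comment> \<open>A load above \<open>l j\<close> here would be truncated, making the total above
    \<open>z\<close> exceed \<open>R z\<close>.\<close>
  have le: "l k \<le> l j" if k: "k \<in> A" "z \<le> t k" for k
  proof (rule ccontr)
    assume "\<not> l k \<le> l j"
    then have "(\<Sum>k | k \<in> A \<and> z \<le> t k. min (l k) (l j)) < (\<Sum>k | k \<in> A \<and> z \<le> t k. l k)"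
      using assms(1) k by (intro sum_strict_mono_ex1) (auto intro!: exI[of _ k])
    then show False using Rz balanced_sum_le[OF assms(2), of z] by simp
  qed
  have Rz': "(\<Sum>k | k \<in> A \<and> z \<le> t k. l k) = R z"
  proof (rule antisym)
    show "R z \<le> (\<Sum>k | k \<in> A \<and> z \<le> t k. l k)"
      using Rz by (rule order_trans) (rule sum_mono, simp)
  qed (rule balanced_sum_le[OF assms(2)])
  have "{k \<in> A. l k \<le> c} = {k \<in> A. l' k \<le> c}" for c
  proof (rule level_sets_eq[OF assms(1)])
    show "(\<Sum>k | k \<in> A \<and> l' k \<le> c. l k) \<le> (\<Sum>k | k \<in> A \<and> l' k \<le> c. l' k)"
      using assms(5) by (intro balanced_lower_level_sum[OF assms(1,2,3)]) simp
    obtain y where y: "{k \<in> A. l k \<le> c} = {k \<in> A. y \<le> t k}"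
      "(\<Sum>k | k \<in> A \<and> l k \<le> c. l k) = R y"
      using balanced_level[OF assms(2)] .
    show "(\<Sum>k | k \<in> A \<and> l k \<le> c. l' k) \<le> (\<Sum>k | k \<in> A \<and> l k \<le> c. l k)"
    \<comment> \<open>A cut outside \<open>(x, t j]\<close> selects the same producers in both
      profiles; one inside it puts \<open>j\<close> in the sublevel set, which then coincides with
      the upper side of \<open>z\<close>.\<close>
    proof (cases "y \<le> x \<or> t j < y")
      case True
      then have "{k \<in> A. y \<le> t k} = {k \<in> A. y \<le> ?t' k}" using assms(5) by auto
      then show ?thesis using y balanced_sum_le[OF assms(3), of y] by simp
    next
      case False
      have "j \<in> {k \<in> A. l k \<le> c}" unfolding y(1) using False assms(4) by simp
      then have "{k \<in> A. z \<le> t k} \<subseteq> {k \<in> A. l k \<le> c}" using le by fastforce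
      moreover have "{k \<in> A. l k \<le> c} \<subseteq> {k \<in> A. z \<le> t k}" unfolding y(1) using False zx by auto
      ultimately have "{k \<in> A. l k \<le> c} = {k \<in> A. z \<le> t k}" by (rule antisym[rotated])
      then show ?thesis using Rz' zt(1) balanced_sum_le[OF assms(3), of z] by simp
    qed
  qed
  then have "l k \<le> c \<longleftrightarrow> l' k \<le> c" for c using assms(7) by blast
  then show ?thesis by (metis order_antisym order_refl)
qed

section \<open>Truncated sums as a potential\<close>

lemma balanced_sum_min_mono:
  assumes "finite A" "balanced A R t l" "balanced A R t' l'" "\<And>k. k \<in> A \<Longrightarrow> t' k \<le> t k" "0 \<le> c"
  shows "(\<Sum>k\<in>A. min (l k) c) \<le> (\<Sum>k\<in>A. min (l' k) c)"
proof -
  obtain y where y: "(\<Sum>k\<in>A. min (l' k) c) = c * card {k \<in> A. t' k < y} + R y"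
    using balanced_cut[OF assms(1,3)] .
  \<comment> \<open>At the minimum cut of the new profile the old one counts no more producers
    below, so its cut bound is no larger.\<close>
  have "{k \<in> A. t k < y} \<subseteq> {k \<in> A. t' k < y}" using assms(4) by force
  then have "card {k \<in> A. t k < y} \<le> card {k \<in> A. t' k < y}"
    using assms(1) by (intro card_mono) auto
  then have "c * card {k \<in> A. t k < y} \<le> c * card {k \<in> A. t' k < y}"
    using assms(5) by (intro mult_left_mono) auto
  then show ?thesis using y balanced_cut_le[OF assms(1,2), of c y] by simp
qed

lemma balanced_sum_min_gain:
  assumes "finite A" "balanced A R t l" "balanced A R (t(j := x)) l'" "j \<in> A" "x \<le> t j"
    and "l j + e \<le> c" "c < l' j"
  shows "(\<Sum>k\<in>A. min (l k) c) + e \<le> (\<Sum>k\<in>A. min (l' k) c)"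
proof -
  let ?t' = "t(j := x)"
  obtain y where y: "{k \<in> A. l' k \<le> c} = {k \<in> A. y \<le> ?t' k}"
    "(\<Sum>k\<in>A. min (l' k) c) = c * card {k \<in> A. ?t' k < y} + R y"
    using balanced_cut[OF assms(1,3)] .
  have xy: "x < y" using Collect_conj_eqD[OF y(1) assms(4)] assms(7) by simp
  show ?thesis
  proof (cases "y \<le> t j")
    case True
    then have "{k \<in> A. ?t' k < y} = insert j {k \<in> A. t k < y}" using xy assms(4) by auto
    then have "card {k \<in> A. ?t' k < y} = Suc (card {k \<in> A. t k < y})"
      using True assms(1) by simp
    then have "(\<Sum>k\<in>A. min (l' k) c) = c + (c * card {k \<in> A. t k < y} + R y)"
      using y(2) by (simp add: algebra_simps)
    then show ?thesis
      using balanced_cut_le[OF assms(1,2), of c y] assms(6) balanced_nonneg[OF assms(2,4)] by linarith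
  next
    case False
    have eq: "{k \<in> A. ?t' k < y} = {k \<in> A. t k < y}" using xy False by auto
    have "(\<Sum>k | k \<in> A \<and> t k < y. min (l k) c) \<le> (\<Sum>k | k \<in> A \<and> t k < y. c - (if k = j then e else 0))"
      using assms(6) by (intro sum_mono) (auto simp: min_def)
    also have "\<dots> = c * card {k \<in> A. t k < y} - e"
      using assms(1,4) False by (simp add: sum_subtractf mult.commute)
    finally have "(\<Sum>k | k \<in> A \<and> t k < y. min (l k) c) \<le> c * card {k \<in> A. t k < y} - e" .
    moreover have "(\<Sum>k | k \<in> A \<and> y \<le> t k. min (l k) c) \<le> (\<Sum>k | k \<in> A \<and> y \<le> t k. l k)"
      by (rule sum_mono) simp
    ultimately show ?thesis
      using balanced_sum_le[OF assms(2), of y] y(2) eq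
        sum_split_threshold[OF assms(1), of "\<lambda>k. min (l k) c" t y] by simp
  qed
qed

text \<open>When all of \<open>M\<close> is served, the producers below a cut \<open>y\<close> carry
  at least \<open>M - R y\<close>, and for a suitable cut those of maximal load carry exactly that.
  Testing the old loads at the new cut and the new loads at the old cut bounds the two maximal loads
  against each other and forces the count up.\<close>

lemma balanced_card_max_less:
  assumes "finite A" "balanced A R t l" "balanced A R (t(j := x)) l'" "j \<in> A" "x \<le> t j"
    and gain: "l j < l' j"
    and max: "\<And>k. k \<in> A \<Longrightarrow> l k \<le> L" and pos: "0 < L"
    and max': "\<And>k. k \<in> A \<Longrightarrow> l' k \<le> l' j"
    and total: "sum l A = M" "sum l' A = M"
  shows "card {k \<in> A. l k = L} < card {k \<in> A. l' k = l' j}"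
proof -
  let ?t' = "t(j := x)" and ?m = "card {k \<in> A. l k = L}" and ?m' = "card {k \<in> A. l' k = l' j}"
  have top: "\<exists>y. {k \<in> A. h k = H} = {k \<in> A. u k < y} \<and> M - R y = H * card {k \<in> A. h k = H}"
    if "balanced A R u h" "\<And>k. k \<in> A \<Longrightarrow> h k \<le> H" "sum h A = M" for u h :: "'a \<Rightarrow> real" and H :: real
  proof -
    note h = that
    obtain y where y: "{k \<in> A. h k < H} = {k \<in> A. y \<le> u k}" "(\<Sum>k | k \<in> A \<and> h k < H. h k) = R y"
      using balanced_strict_level[OF assms(1) h(1)] .
    have *: "{k \<in> A. h k = H} = {k \<in> A. u k < y}" using y(1) h(2) by force
    have "(\<Sum>k | k \<in> A \<and> h k = H. h k) = H * card {k \<in> A. h k = H}" by (simp add: mult.commute)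
    then show ?thesis
      using * y sum_split_threshold[OF assms(1), of h u y] h(3) by (intro exI[of _ y]) auto
  qed
  have cap: "M - R y \<le> H * card {k \<in> A. u k < y}"
    if "balanced A R u h" "\<And>k. k \<in> A \<Longrightarrow> h k \<le> H" "sum h A = M" for u h :: "'a \<Rightarrow> real" and H y
  proof -
    have "(\<Sum>k | k \<in> A \<and> u k < y. h k) \<le> (\<Sum>k | k \<in> A \<and> u k < y. H)"
      using that(2) by (intro sum_mono) auto
    then show ?thesis
      using sum_split_threshold[OF assms(1), of h u y] balanced_sum_le[OF that(1), of y] that(3)
      by (simp add: mult.commute)
  qed
  obtain y where y: "{k \<in> A. l k = L} = {k \<in> A. t k < y}" "M - R y = L * ?m"
    using top[OF assms(2) max total(1)] by blast
  obtain y' where y': "{k \<in> A. l' k = l' j} = {k \<in> A. ?t' k < y'}" "M - R y' = l' j * ?m'"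
    using top[OF assms(3) max' total(2)] by blast
  have xy': "x < y'" using Collect_conj_eqD[OF y'(1) assms(4)] by simp
  have m'_pos: "?m' > 0" using assms(1,4) by (auto simp: card_gt_0_iff)
  have low: "l' j * ?m' \<le> L * (real ?m' - 1)" if "y' \<le> t j"
  proof -
    have "{k \<in> A. ?t' k < y'} = insert j {k \<in> A. t k < y'}" using xy' assms(4) by auto
    then have "?m' = Suc (card {k \<in> A. t k < y'})" using y'(1) that assms(1) by simp
    then show ?thesis using cap[OF assms(2) max total(1), of y'] y'(2) by simp
  qed
  have high: "l' j * ?m' \<le> L * real ?m'" if "t j < y'"
  proof -
    have "{k \<in> A. ?t' k < y'} = {k \<in> A. t k < y'}" using xy' that by auto
    then show ?thesis using cap[OF assms(2) max total(1), of y'] y' by simp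
  qed
  have "l' j * ?m' \<le> L * real ?m'" using low high pos by (cases "y' \<le> t j") (auto simp: algebra_simps)
  \<comment> \<open>\<open>L\<close> still bounds the new loads, and the gain shows that
    \<open>j\<close> was strictly below \<open>L\<close> before.\<close>
  then have "l' j \<le> L" using m'_pos by simp
  then have jL: "l j \<noteq> L" using gain by simp
  then have yt: "y \<le> t j" using Collect_conj_eqD[OF y(1) assms(4)] by simp
  show ?thesis
  proof (cases "y' \<le> t j")
    case True
    have "{k \<in> A. ?t' k < y} \<subseteq> insert j {k \<in> A. t k < y}" by auto
    then have "card {k \<in> A. ?t' k < y} \<le> card (insert j {k \<in> A. t k < y})"
      using assms(1) by (intro card_mono) auto
    also have "\<dots> \<le> Suc ?m" unfolding y(1) by (rule card_insert_le_m1) auto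
    finally have "real (card {k \<in> A. ?t' k < y}) \<le> real ?m + 1" by linarith
    moreover have "0 \<le> l' j" using balanced_nonneg[OF assms(3,4)] .
    ultimately have "l' j * card {k \<in> A. ?t' k < y} \<le> l' j * (real ?m + 1)"
      by (intro mult_left_mono)
    then have 1: "L * ?m \<le> l' j * (real ?m + 1)"
      using cap[OF assms(3) max' total(2), of y] y(2) by simp
    show ?thesis
    proof (rule ccontr)
      assume "\<not> ?thesis"
      then have le: "real ?m' \<le> real ?m" by simp
      \<comment> \<open>Combining the two bounds and cancelling \<open>L\<close> leaves
        \<open>?m * ?m' \<le> (?m' - 1) * (?m + 1)\<close>, that is
        \<open>?m' \<ge> ?m + 1\<close>.\<close>
      have "L * ?m * ?m' \<le> l' j * (real ?m + 1) * ?m'"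
        using 1 by (intro mult_right_mono) auto
      also have "\<dots> = l' j * ?m' * (real ?m + 1)" by simp
      also have "\<dots> \<le> L * (real ?m' - 1) * (real ?m + 1)"
        using low[OF True] by (intro mult_right_mono) auto
      finally have "L * (real ?m * ?m') \<le> L * ((real ?m' - 1) * (real ?m + 1))" by (simp add: mult.assoc)
      then have "real ?m * ?m' \<le> (real ?m' - 1) * (real ?m + 1)" using pos by simp
      then show False using le by (simp add: algebra_simps)
    qed
  next
    case False
    then have "insert j {k \<in> A. l k = L} \<subseteq> {k \<in> A. l' k = l' j}"
      unfolding y(1) y'(1) using xy' yt assms(4) by auto
    then have "card (insert j {k \<in> A. l k = L}) \<le> ?m'" using assms(1) by (intro card_mono) auto
    then show ?thesis using jL assms(1) by simp
  qed
qed

text \<open>A constant load has only two sublevel sets: all of \<open>A\<close>, cut at 0, and the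
  empty set, cut beyond all thresholds at \<open>y1\<close>.\<close>

lemma balanced_const:
  fixes c :: real
  assumes "\<And>k. k \<in> A \<Longrightarrow> 0 \<le> t k" "0 \<le> c" "c * card A = R 0"
    and "\<And>y. c * card {k \<in> A. y \<le> t k} \<le> R y"
    and "y1 > 0" "\<And>k. k \<in> A \<Longrightarrow> t k < y1" "R y1 = 0"
  shows "balanced A R t (\<lambda>_. c)"
  unfolding balanced_def
proof (intro conjI allI ballI)
  fix b
  show "\<exists>y. {k \<in> A. c \<le> b} = {k \<in> A. y \<le> t k} \<and> (\<Sum>k | k \<in> A \<and> c \<le> b. c) = R y"
  proof (cases "c \<le> b")
    case True
    then have "{k \<in> A. c \<le> b} = A" "{k \<in> A. 0 \<le> t k} = A" using assms(1) by auto
    then show ?thesis using assms(3) by (intro exI[of _ 0]) (simp add: mult.commute)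
  next
    case False
    then have "{k \<in> A. c \<le> b} = {k \<in> A. y1 \<le> t k} \<and> (\<Sum>k | k \<in> A \<and> c \<le> b. c) = R y1"
      using assms(6,7) by force
    then show ?thesis by blast
  qed
qed (use assms in \<open>auto simp: mult.commute\<close>)

section \<open>Existence and uniqueness of equilibrium loads\<close>

lemma water_level:
  fixes l :: "'a \<Rightarrow> real"
  assumes "finite S" "S \<noteq> {}" "\<And>k. k \<in> S \<Longrightarrow> 0 \<le> l k" "0 \<le> m"
  obtains w where "(\<Sum>k\<in>S. max 0 (w - l k)) = m"
proof -
  obtain k0 where k0: "k0 \<in> S" using assms(2) by blast
  have "\<exists>w\<ge>0. w \<le> l k0 + m \<and> (\<Sum>k\<in>S. max 0 (w - l k)) = m"
  proof (rule IVT')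
    show "(\<Sum>k\<in>S. max 0 (0 - l k)) \<le> m"
      using assms(3,4) by (subst sum.neutral) (auto simp: max.absorb1)
    have "m \<le> max 0 (l k0 + m - l k0)" by simp
    also have "\<dots> \<le> (\<Sum>k\<in>S. max 0 (l k0 + m - l k))"
      by (rule member_le_sum[OF k0 _ assms(1)]) simp
    finally show "m \<le> (\<Sum>k\<in>S. max 0 (l k0 + m - l k))" .
    show "0 \<le> l k0 + m" using assms(3)[OF k0] assms(4) by simp
  qed (intro continuous_intros)
  then show ?thesis using that by blast
qed

text \<open>
  Pouring the mass of the largest set last raises every load below the water level to that level;
  as all earlier sets are contained in this one, their equilibrium conditions survive.
\<close>

lemma water_filling:
  fixes m :: "nat \<Rightarrow> real" and S :: "nat \<Rightarrow> 'a set"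
  assumes "finite A" "\<And>i. S i \<subseteq> A" "mono S" "\<And>i. 0 \<le> m i"
  shows "\<exists>q. \<forall>i<r. (\<forall>k. 0 \<le> q i k) \<and> (\<forall>k. q i k \<noteq> 0 \<longrightarrow> k \<in> S i) \<and>
           (S i \<noteq> {} \<longrightarrow> (\<Sum>k\<in>A. q i k) = 1) \<and>
           (\<forall>k j. q i k \<noteq> 0 \<longrightarrow> j \<in> S i \<longrightarrow> (\<Sum>e<r. m e * q e k) \<le> (\<Sum>e<r. m e * q e j))"
proof (induction r)
  case 0
  then show ?case by simp
next
  case (Suc r)
  from Suc.IH obtain q where q: "\<forall>i<r. (\<forall>k. 0 \<le> q i k) \<and> (\<forall>k. q i k \<noteq> 0 \<longrightarrow> k \<in> S i) \<and>
      (S i \<noteq> {} \<longrightarrow> (\<Sum>k\<in>A. q i k) = 1) \<and>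
      (\<forall>k j. q i k \<noteq> 0 \<longrightarrow> j \<in> S i \<longrightarrow> (\<Sum>e<r. m e * q e k) \<le> (\<Sum>e<r. m e * q e j))" ..
  have nonneg: "0 \<le> q i k" if "i < r" for i k using q that by simp
  have supp: "k \<in> S i" if "i < r" "q i k \<noteq> 0" for i k using q that by simp
  have total: "(\<Sum>k\<in>A. q i k) = 1" if "i < r" "S i \<noteq> {}" for i using q that by simp
  have eq: "(\<Sum>e<r. m e * q e k) \<le> (\<Sum>e<r. m e * q e j)" if "i < r" "q i k \<noteq> 0" "j \<in> S i" for i k j
    using q that by simp
  define l where "l k = (\<Sum>e<r. m e * q e k)" for k
  have l_nonneg: "0 \<le> l k" for k
    unfolding l_def using nonneg assms(4) by (intro sum_nonneg mult_nonneg_nonneg) auto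
  have fin: "finite (S r)" using assms(1,2) finite_subset by blast
  have sum_S: "(\<Sum>k\<in>A. p k) = (\<Sum>k\<in>S r. p k)" if "\<And>k. k \<notin> S r \<Longrightarrow> p k = 0" for p :: "'a \<Rightarrow> real"
    using assms(1,2) that by (intro sum.mono_neutral_right) auto
  \<comment> \<open>\<open>f\<close> maps old loads to new ones on \<open>S r\<close>. Being
    monotone, it preserves the comparisons made by the earlier sets.\<close>
  have "\<exists>p f. (\<forall>k. 0 \<le> p k) \<and> (\<forall>k. p k \<noteq> 0 \<longrightarrow> k \<in> S r) \<and> (S r \<noteq> {} \<longrightarrow> (\<Sum>k\<in>A. p k) = 1) \<and>
           mono f \<and> (\<forall>k\<in>S r. l k + m r * p k = f (l k)) \<and>
           (\<forall>k j. p k \<noteq> 0 \<longrightarrow> j \<in> S r \<longrightarrow> f (l k) \<le> f (l j))"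
  proof (cases "S r = {} \<or> m r = 0")
    case True
    show ?thesis
    proof (cases "S r = {}")
      case True
      then show ?thesis by (intro exI[of _ "\<lambda>_. 0"] exI[of _ id]) (auto simp: mono_def)
    next
      case False
      \<comment> \<open>A stage without mass must still choose a least loaded producer, since
        equilibrium is required of types of measure zero too.\<close>
      define b where "b = arg_min_on l (S r)"
      have b: "b \<in> S r" "\<And>j. j \<in> S r \<Longrightarrow> l b \<le> l j"
        unfolding b_def using arg_min_if_finite(1)[OF fin False, of l] arg_min_least[OF fin False, of _ l]
        by auto
      have "(\<Sum>k\<in>A. if k = b then 1 else 0 :: real) = 1"
        using b(1) assms(1,2) by (auto simp: subset_iff)
      then show ?thesis
        using b \<open>S r = {} \<or> m r = 0\<close> False
        by (intro exI[of _ "\<lambda>k. if k = b then 1 else 0"] exI[of _ id]) (auto simp: mono_def)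
    qed
  next
    case False
    then have pos: "m r > 0" using assms(4)[of r] by simp
    obtain w where w: "(\<Sum>k\<in>S r. max 0 (w - l k)) = m r"
      using water_level[of "S r" l "m r"] fin False l_nonneg pos by auto
    define p where "p k = (if k \<in> S r then max 0 (w - l k) / m r else 0)" for k
    have "(\<Sum>k\<in>A. p k) = (\<Sum>k\<in>S r. max 0 (w - l k) / m r)"
      by (subst sum_S) (auto simp: p_def)
    also have "\<dots> = 1" using w pos by (simp flip: sum_divide_distrib)
    finally have "(\<Sum>k\<in>A. p k) = 1" .
    then show ?thesis
      using pos by (intro exI[of _ p] exI[of _ "max w"]) (auto simp: p_def mono_def max_def split: if_splits)
  qed
  then obtain p f where pf: "(\<forall>k. 0 \<le> p k) \<and> (\<forall>k. p k \<noteq> 0 \<longrightarrow> k \<in> S r) \<and>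
      (S r \<noteq> {} \<longrightarrow> (\<Sum>k\<in>A. p k) = 1) \<and> mono f \<and> (\<forall>k\<in>S r. l k + m r * p k = f (l k)) \<and>
      (\<forall>k j. p k \<noteq> 0 \<longrightarrow> j \<in> S r \<longrightarrow> f (l k) \<le> f (l j))"
    by (elim exE)
  have p: "0 \<le> p k" "p k \<noteq> 0 \<Longrightarrow> k \<in> S r" "S r \<noteq> {} \<Longrightarrow> (\<Sum>k\<in>A. p k) = 1" "mono f"
    "k \<in> S r \<Longrightarrow> l k + m r * p k = f (l k)" "p k \<noteq> 0 \<Longrightarrow> j \<in> S r \<Longrightarrow> f (l k) \<le> f (l j)" for k j
    using pf by simp_all
  define q' where "q' = q(r := p)"
  have load: "(\<Sum>e<Suc r. m e * q' e k) = f (l k)" if "k \<in> S r" for k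
    using p(5)[OF that] by (simp add: q'_def l_def)
  have sub: "S i \<subseteq> S r" if "i < r" for i using assms(3) that by (simp add: mono_def)
  show ?case
  proof (intro exI[of _ q'] allI impI conjI)
    fix i k assume "i < Suc r"
    then show "0 \<le> q' i k" using nonneg p(1) by (auto simp: q'_def less_Suc_eq)
  next
    fix i k assume "i < Suc r" "q' i k \<noteq> 0"
    then show "k \<in> S i" using supp p(2) by (auto simp: q'_def less_Suc_eq)
  next
    fix i assume "i < Suc r" "S i \<noteq> {}"
    then show "(\<Sum>k\<in>A. q' i k) = 1" using total p(3) by (auto simp: q'_def less_Suc_eq)
  next
    fix i k j assume i: "i < Suc r" and k: "q' i k \<noteq> 0" and j: "j \<in> S i"
    have "f (l k) \<le> f (l j) \<and> k \<in> S r \<and> j \<in> S r"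
    proof (cases "i = r")
      case True
      then show ?thesis using k j p(2,6) by (auto simp: q'_def)
    next
      case False
      then have "i < r" "q i k \<noteq> 0" using i k by (auto simp: q'_def)
      then show ?thesis
        using eq[of i k j] supp[of i k] sub[of i] j p(4) by (auto simp: l_def mono_def)
    qed
    then show "(\<Sum>e<Suc r. m e * q' e k) \<le> (\<Sum>e<Suc r. m e * q' e j)" using load by simp
  qed
qed

section \<open>Loads of consumer equilibria\<close>

definition upper_mass :: "real measure \<Rightarrow> real \<Rightarrow> real" where
  "upper_mass \<mu> y = measure \<mu> {d \<in> space \<mu>. y \<le> d}"

lemma space_measure_on_types: "measure_on_types \<mu> \<Longrightarrow> space \<mu> = {0..1}"
  unfolding measure_on_types_def by (drule sets_eq_imp_space_eq) (simp add: space_restrict_space types_def)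

lemma borel_measurable_id_on_types: "measure_on_types \<mu> \<Longrightarrow> (\<lambda>d. d) \<in> borel_measurable \<mu>"
  unfolding measure_on_types_def
  by (subst measurable_cong_sets[of _ "restrict_space borel \<T>" _ borel]) (auto intro: measurable_restrict_space1)

lemma sum_strategies:
  "(\<Sum>a\<in>strategies n. f a) = f None + (\<Sum>k\<in>\<P> n. f (Some k))" for f :: "nat option \<Rightarrow> real"
  unfolding strategies_def producers_def by (subst sum.insert) (auto simp: sum.reindex)

lemma
  assumes "mixed_consumption n \<mu> t s" "measure_on_types \<mu>"
  shows mixed_consumption_measurable: "a \<in> strategies n \<Longrightarrow> (\<lambda>d. s d a) \<in> borel_measurable \<mu>"
    and mixed_consumption_range: "a \<in> strategies n \<Longrightarrow> d \<in> \<T> \<Longrightarrow> s d a \<in> {0..1}"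
proof -
  assume a: "a \<in> strategies n"
  have "(\<lambda>d. s d a) \<in> measurable \<mu> (restrict_space borel {0..1::real})"
    using assms(1) a unfolding mixed_consumption_def
    by (auto intro: measurable_compose[OF _ measurable_component_singleton])
  then have *: "(\<lambda>d. s d a) \<in> borel_measurable \<mu>" "(\<lambda>d. s d a) \<in> space \<mu> \<rightarrow> {0..1}"
    by (auto simp: measurable_restrict_space2_iff)
  show "(\<lambda>d. s d a) \<in> borel_measurable \<mu>" using * by simp
  show "s d a \<in> {0..1}" if "d \<in> \<T>"
    using * that space_measure_on_types[OF assms(2)] by (auto simp: types_def)
qed

lemma mixed_consumption_zero:
  assumes "mixed_consumption n \<mu> t s" "d \<in> \<T>" "k \<in> \<P> n" "d < t k"
  shows "s d (Some k) = 0"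
proof (rule ccontr)
  assume "s d (Some k) \<noteq> 0"
  then have "Some k \<in> support n (s d)" using assms(3) by (simp add: support_def strategies_def)
  then have "Some k \<in> strategies_of n t d" using assms(1,2) unfolding mixed_consumption_def by blast
  then show False using assms(4) by (auto simp: strategies_of_def)
qed

text \<open>No type below \<open>y\<close> can use a producer with threshold at least
  \<open>y\<close>, which gives the upper bounds. If \<open>y\<close> is the lowest threshold among
  the producers of load at most \<open>c\<close>, every type from \<open>y\<close> on can reach one
  of them and so consumes only within that set.\<close>

lemma balanced_consumer_equilibrium:
  assumes eq: "consumer_equilibrium n \<mu> t s" and \<mu>: "measure_on_types \<mu>" "finite_measure \<mu>"
  shows "balanced (\<P> n) (upper_mass \<mu>) t (profile_load \<mu> s)"
proof -
  interpret finite_measure \<mu> by fact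
  let ?l = "profile_load \<mu> s"
  have mixed: "mixed_consumption n \<mu> t s" using eq by (simp add: consumer_equilibrium_def)
  note space = space_measure_on_types[OF \<mu>(1)] and [measurable] = borel_measurable_id_on_types[OF \<mu>(1)]
  have prod: "Some k \<in> strategies n" if "k \<in> \<P> n" for k using that by (simp add: strategies_def)
  have range: "0 \<le> s d (Some k)" "s d (Some k) \<le> 1" if "k \<in> \<P> n" "d \<in> \<T>" for k d
    using mixed_consumption_range[OF mixed \<mu>(1) prod that(2)] that by auto
  have sum_le: "(\<Sum>k\<in>B. s d (Some k)) \<le> 1" if "B \<subseteq> \<P> n" "d \<in> \<T>" for B d
  proof -
    have "(\<Sum>k\<in>B. s d (Some k)) \<le> (\<Sum>k\<in>\<P> n. s d (Some k))"
      using that range by (intro sum_mono2) (auto simp: producers_def)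
    also have "\<dots> \<le> 1"
      using mixed that(2) mixed_consumption_range[OF mixed \<mu>(1), of None d] sum_strategies[of "s d" n]
      by (auto simp: mixed_consumption_def strategies_def)
    finally show ?thesis .
  qed
  have int: "integrable \<mu> (\<lambda>d. s d (Some k))" if "k \<in> \<P> n" for k
    using range that space mixed_consumption_measurable[OF mixed \<mu>(1) prod[OF that]]
    by (intro integrable_const_bound[where B = 1]) (auto simp: types_def)
  have sum_load: "(\<Sum>k\<in>B. ?l k) = (LINT d|\<mu>. (\<Sum>k\<in>B. s d (Some k)))" if "B \<subseteq> \<P> n" for B
    unfolding profile_load_def using int that by (subst Bochner_Integration.integral_sum) auto
  have mass: "upper_mass \<mu> y = (LINT d|\<mu>. indicator {d. y \<le> d} d)" for y
  proof -
    have "(LINT d|\<mu>. indicator {d. y \<le> d} d) = measure \<mu> ({d. y \<le> d} \<inter> space \<mu>)"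
      by (rule Bochner_Integration.integral_indicator)
    then show ?thesis by (simp add: upper_mass_def Int_def conj_commute)
  qed
  have below: "(\<Sum>k\<in>B. s d (Some k)) = 0" if "B \<subseteq> {k \<in> \<P> n. y \<le> t k}" "d \<in> \<T>" "d < y" for B d y
    using that by (intro sum.neutral ballI mixed_consumption_zero[OF mixed]) auto
  have choice: "?l k \<le> ?l j" if "d \<in> \<T>" "k \<in> \<P> n" "j \<in> \<P> n" "s d (Some k) \<noteq> 0" "t j \<le> d" for d k j
    using eq that prod unfolding consumer_equilibrium_def support_def strategies_of_def by blast
  have nonneg: "0 \<le> ?l k" if "k \<in> \<P> n" for k
    unfolding profile_load_def using range that space
    by (intro Bochner_Integration.integral_nonneg) (auto simp: types_def)
  \<comment> \<open>Every type that reaches \<open>k\<close> also reaches \<open>j\<close>. Were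
    \<open>j\<close> strictly less loaded, nobody would use \<open>k\<close>, whose load would be
    0.\<close>
  have antimono: "?l k \<le> ?l j" if "k \<in> \<P> n" "j \<in> \<P> n" "t j \<le> t k" for k j
  proof (rule ccontr)
    assume *: "\<not> ?l k \<le> ?l j"
    have "s d (Some k) = 0" if "d \<in> space \<mu>" for d
    proof (rule ccontr)
      assume "s d (Some k) \<noteq> 0"
      moreover have "d \<in> \<T>" using that space by (simp add: types_def)
      ultimately have "t k \<le> d" using mixed_consumption_zero[OF mixed] \<open>k \<in> \<P> n\<close> by force
      then show False
        using choice[of d k j] * \<open>s d (Some k) \<noteq> 0\<close> \<open>d \<in> \<T>\<close> \<open>k \<in> \<P> n\<close> \<open>j \<in> \<P> n\<close> \<open>t j \<le> t k\<close> by simp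
    qed
    then have "?l k = (LINT d|\<mu>. 0)"
      unfolding profile_load_def by (intro Bochner_Integration.integral_cong) auto
    then have "?l k = 0" by simp
    then show False using * nonneg[of j] that by simp
  qed
  show ?thesis
    unfolding balanced_def
  proof (intro conjI allI ballI)
    fix k assume "k \<in> \<P> n" then show "0 \<le> ?l k" by (rule nonneg)
  next
    fix y
    have "(\<Sum>k | k \<in> \<P> n \<and> y \<le> t k. ?l k) = (LINT d|\<mu>. (\<Sum>k | k \<in> \<P> n \<and> y \<le> t k. s d (Some k)))"
      by (rule sum_load) auto
    also have "\<dots> \<le> (LINT d|\<mu>. indicator {d. y \<le> d} d)"
    proof (rule integral_mono)
      fix d assume "d \<in> space \<mu>"
      then have "d \<in> \<T>" using space by (simp add: types_def)
      then show "(\<Sum>k | k \<in> \<P> n \<and> y \<le> t k. s d (Some k)) \<le> (indicator {d. y \<le> d} d :: real)"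
        using sum_le[of "{k \<in> \<P> n. y \<le> t k}" d] below[of "{k \<in> \<P> n. y \<le> t k}" y d]
        by (cases "y \<le> d") auto
    qed (auto intro!: Bochner_Integration.integrable_sum int integrable_const_bound[where B = 1])
    finally show "(\<Sum>k | k \<in> \<P> n \<and> y \<le> t k. ?l k) \<le> upper_mass \<mu> y" using mass by simp
  next
    fix c
    let ?B = "{k \<in> \<P> n. ?l k \<le> c}"
    show "\<exists>y. ?B = {k \<in> \<P> n. y \<le> t k} \<and> (\<Sum>k | k \<in> \<P> n \<and> ?l k \<le> c. ?l k) = upper_mass \<mu> y"
    proof (cases "?B = {}")
      case True
      define y where "y = Max (insert 1 (t ` \<P> n)) + 1"
      have fin: "finite (insert 1 (t ` \<P> n))" by (simp add: producers_def)
      have "1 < y" using Max_ge[OF fin, of 1] by (simp add: y_def)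
      then have "{d \<in> space \<mu>. y \<le> d} = {}" using space by auto
      then have "upper_mass \<mu> y = 0" by (simp only: upper_mass_def measure_empty)
      moreover have "t k < y" if "k \<in> \<P> n" for k
        using Max_ge[OF fin, of "t k"] that by (simp add: y_def)
      then have "{k \<in> \<P> n. y \<le> t k} = {}" by force
      ultimately show ?thesis using True by (metis sum.empty)
    next
      case False
      define y where "y = Min (t ` ?B)"
      have finB: "finite ?B" by (simp add: producers_def)
      have "y \<in> t ` ?B" unfolding y_def using False finB by (intro Min_in) auto
      then obtain b where b: "b \<in> \<P> n" "?l b \<le> c" "y = t b" by auto
      have ymin: "y \<le> t k" if "k \<in> ?B" for k
        unfolding y_def using finB that by (intro Min_le) auto
      have B: "?B = {k \<in> \<P> n. y \<le> t k}"
      proof (intro equalityI subsetI)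
        fix k assume "k \<in> {k \<in> \<P> n. y \<le> t k}"
        then show "k \<in> ?B" using antimono[of k b] b by auto
      qed (use ymin in auto)
      have "(\<Sum>k\<in>?B. s d (Some k)) = indicator {d. y \<le> d} d" if "d \<in> space \<mu>" for d
      proof -
        have d: "d \<in> \<T>" using space that by (simp add: types_def)
        show ?thesis
        proof (cases "y \<le> d")
          case True
          have "Some b \<in> strategies_of n t d" using True b by (simp add: strategies_of_def)
          then have "None \<notin> support n (s d)" using eq d unfolding consumer_equilibrium_def by blast
          then have "s d None = 0" by (simp add: support_def strategies_def)
          then have "1 = (\<Sum>k\<in>\<P> n. s d (Some k))"
            using mixed d sum_strategies[of "s d" n] by (simp add: mixed_consumption_def)
          also have "\<dots> = (\<Sum>k\<in>?B. s d (Some k))"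
          proof (rule sum.mono_neutral_right)
            show "\<forall>k\<in>\<P> n - ?B. s d (Some k) = 0"
            proof
              fix k assume "k \<in> \<P> n - ?B"
              then show "s d (Some k) = 0" using choice[OF d _ b(1), of k] b(2,3) True by force
            qed
          qed (auto simp: producers_def)
          finally show ?thesis using True by simp
        next
          case False
          then show ?thesis using below[of ?B y d] B d by simp
        qed
      qed
      then have "(LINT d|\<mu>. (\<Sum>k\<in>?B. s d (Some k))) = upper_mass \<mu> y"
        unfolding mass by (intro Bochner_Integration.integral_cong) auto
      then show ?thesis using sum_load[of ?B] B by (intro exI[of _ y]) auto
    qed
  qed
qed

lemma consumer_equilibrium_exists:
  assumes \<mu>: "measure_on_types \<mu>" "finite_measure \<mu>"
  shows "\<exists>s. consumer_equilibrium n \<mu> t s"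
proof -
  interpret finite_measure \<mu> by fact
  note space = space_measure_on_types[OF \<mu>(1)] and [measurable] = borel_measurable_id_on_types[OF \<mu>(1)]
  \<comment> \<open>The strategies of \<open>d\<close> depend on \<open>d\<close> only through \<open>N d\<close>, which reduces the game to finitely many cells.\<close>
  define N where "N d = card {k \<in> \<P> n. t k \<le> d}" for d
  \<comment> \<open>Defined for all \<open>i\<close>, attained by \<open>N\<close> or not, so that
    \<open>S\<close> is increasing as water filling requires; \<open>S (N d)\<close> recovers the
    producers open to \<open>d\<close>.\<close>
  define S where "S i = {k \<in> \<P> n. N (t k) \<le> i}" for i
  define m where "m i = measure \<mu> {d \<in> space \<mu>. N d = i}" for i
  have fin: "finite (\<P> n)" by (simp add: producers_def)
  have N_le: "N d < Suc n" for d
    using card_mono[OF fin, of "{k \<in> \<P> n. t k \<le> d}"] by (auto simp: N_def producers_def less_Suc_eq_le)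
  have S_N: "S (N d) = {k \<in> \<P> n. t k \<le> d}" for d
  proof -
    have "N (t k) \<le> N d \<longleftrightarrow> t k \<le> d" if "k \<in> \<P> n" for k
    proof
      assume "t k \<le> d"
      then show "N (t k) \<le> N d" unfolding N_def using fin by (intro card_mono) auto
    next
      assume *: "N (t k) \<le> N d"
      show "t k \<le> d"
      proof (rule ccontr)
        assume "\<not> t k \<le> d"
        then have "{k \<in> \<P> n. t k \<le> d} \<subset> {i \<in> \<P> n. t i \<le> t k}" using that by fastforce
        then have "N d < N (t k)" unfolding N_def using fin by (intro psubset_card_mono) auto
        then show False using * by simp
      qed
    qed
    then show ?thesis unfolding S_def by blast
  qed
  have "\<exists>q. \<forall>i<Suc n. (\<forall>k. 0 \<le> q i k) \<and> (\<forall>k. q i k \<noteq> 0 \<longrightarrow> k \<in> S i) \<and>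
      (S i \<noteq> {} \<longrightarrow> (\<Sum>k\<in>\<P> n. q i k) = 1) \<and>
      (\<forall>k j. q i k \<noteq> 0 \<longrightarrow> j \<in> S i \<longrightarrow> (\<Sum>e<Suc n. m e * q e k) \<le> (\<Sum>e<Suc n. m e * q e j))"
    by (rule water_filling) (auto simp: fin S_def mono_def m_def)
  then obtain q where q: "\<forall>i<Suc n. (\<forall>k. 0 \<le> q i k) \<and> (\<forall>k. q i k \<noteq> 0 \<longrightarrow> k \<in> S i) \<and>
      (S i \<noteq> {} \<longrightarrow> (\<Sum>k\<in>\<P> n. q i k) = 1) \<and>
      (\<forall>k j. q i k \<noteq> 0 \<longrightarrow> j \<in> S i \<longrightarrow> (\<Sum>e<Suc n. m e * q e k) \<le> (\<Sum>e<Suc n. m e * q e j))" ..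
  have nonneg: "0 \<le> q i k" if "i < Suc n" for i k using q that by blast
  have supp: "k \<in> S i" if "i < Suc n" "q i k \<noteq> 0" for i k using q that by blast
  have total: "(\<Sum>k\<in>\<P> n. q i k) = 1" if "i < Suc n" "S i \<noteq> {}" for i using q that by blast
  have eq: "(\<Sum>e<Suc n. m e * q e k) \<le> (\<Sum>e<Suc n. m e * q e j)"
    if "i < Suc n" "q i k \<noteq> 0" "j \<in> S i" for i k j
    using q that by blast
  define p where "p i a = (case a of None \<Rightarrow> if S i = {} then 1 else 0 | Some k \<Rightarrow> q i k)" for i a
  define s where "s d = restrict (p (N d)) (strategies n)" for d
  have p_nonneg: "0 \<le> p i a" if "i < Suc n" for i a
    using nonneg[OF that] by (auto simp: p_def split: option.split)
  have p_sum: "(\<Sum>a\<in>strategies n. p i a) = 1" if "i < Suc n" for i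
  proof (cases "S i = {}")
    case True
    then have "q i k = 0" for k using supp[OF that, of k] by auto
    then show ?thesis using True by (simp add: sum_strategies p_def)
  next
    case False
    then show ?thesis using total[OF that] by (simp add: sum_strategies p_def)
  qed
  have p_le: "p i a \<le> 1" if "i < Suc n" "a \<in> strategies n" for i a
    using member_le_sum[of a "strategies n" "p i"] p_nonneg p_sum that
    by (auto simp: strategies_def producers_def)
  have N_meas[measurable]: "N \<in> measurable \<mu> (count_space UNIV)"
  proof -
    have "N = (\<lambda>d. \<Sum>k\<in>\<P> n. if t k \<le> d then 1 else 0)"
      unfolding N_def using fin by (simp add: sum.If_cases Int_def fun_eq_iff)
    then show ?thesis by simp
  qed
  have p_meas: "(\<lambda>d. p (N d) a) \<in> borel_measurable \<mu>" for a
    by (rule measurable_compose[OF N_meas]) simp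
  have load: "profile_load \<mu> s k = (\<Sum>e<Suc n. m e * q e k)" if "k \<in> \<P> n" for k
  proof -
    have "s d (Some k) = (\<Sum>e<Suc n. indicator {d \<in> space \<mu>. N d = e} d * q e k)" if "d \<in> space \<mu>" for d
    proof -
      have "(\<Sum>e<Suc n. indicator {d \<in> space \<mu>. N d = e} d * q e k) = (\<Sum>e<Suc n. if e = N d then q e k else 0)"
        using that by (intro sum.cong) auto
      also have "\<dots> = q (N d) k" using N_le[of d] by (subst sum.delta) auto
      finally show ?thesis using \<open>k \<in> \<P> n\<close> by (simp add: s_def p_def strategies_def)
    qed
    then have "profile_load \<mu> s k = (LINT d|\<mu>. (\<Sum>e<Suc n. indicator {d \<in> space \<mu>. N d = e} d * q e k))"
      unfolding profile_load_def by (intro Bochner_Integration.integral_cong) auto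
    also have "\<dots> = (\<Sum>e<Suc n. (LINT d|\<mu>. indicator {d \<in> space \<mu>. N d = e} d * q e k))"
      by (intro Bochner_Integration.integral_sum integrable_mult_left integrable_real_indicator)
        (auto simp: less_top[symmetric])
    also have "\<dots> = (\<Sum>e<Suc n. m e * q e k)"
      unfolding m_def by (intro sum.cong refl) (simp add: Int_absorb2 subset_iff)
    finally show ?thesis .
  qed
  have "s \<in> measurable \<mu> (PiM (strategies n) (\<lambda>_. restrict_space borel {0..1}))"
    unfolding s_def
  proof (rule measurable_restrict)
    fix a assume "a \<in> strategies n"
    then show "(\<lambda>d. p (N d) a) \<in> measurable \<mu> (restrict_space borel {0..1})"
      using p_meas p_nonneg p_le N_le by (intro measurable_restrict_space2) auto
  qed
  moreover have "(\<Sum>a\<in>strategies n. s d a) = 1" for d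
    using p_sum[OF N_le] by (simp add: s_def)
  moreover have "support n (s d) \<subseteq> strategies_of n t d" for d
    using supp[OF N_le] S_N[of d]
    by (auto simp: support_def s_def p_def strategies_of_def strategies_def split: if_splits)
  moreover have "strategies_of n t d = {None}" if "None \<in> support n (s d)" for d
    using that S_N[of d] by (auto simp: support_def s_def p_def strategies_of_def strategies_def split: if_splits)
  moreover have "profile_load \<mu> s k \<le> profile_load \<mu> s j"
    if k: "Some k \<in> support n (s d)" and j: "Some j \<in> strategies_of n t d" for d k j
  proof -
    have "k \<in> \<P> n" "q (N d) k \<noteq> 0" using k by (auto simp: support_def s_def p_def strategies_def)
    moreover have "j \<in> \<P> n" "j \<in> S (N d)" using j S_N[of d] by (auto simp: strategies_of_def)
    ultimately show ?thesis using eq[OF N_le] load by simp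
  qed
  ultimately have "consumer_equilibrium n \<mu> t s"
    unfolding consumer_equilibrium_def mixed_consumption_def by blast
  then show ?thesis by blast
qed

text \<open>Equilibria exist and balanced loads are unique, so the description in
  \<open>load\<close> is meaningful. From here on consumers enter only through balancedness.\<close>

lemma balanced_load:
  assumes "measure_on_types \<mu>" "finite_measure \<mu>"
  shows "balanced (\<P> n) (upper_mass \<mu>) t (load n \<mu> t)"
proof -
  obtain s where s: "consumer_equilibrium n \<mu> t s"
    using consumer_equilibrium_exists[OF assms] by blast
  have "load n \<mu> t j = profile_load \<mu> s j" if "j \<in> \<P> n" for j
    unfolding load_def
  proof (rule the_equality)
    fix x assume "\<exists>s. consumer_equilibrium n \<mu> t s \<and> profile_load \<mu> s j = x"
    then obtain s' where s': "consumer_equilibrium n \<mu> t s'" "profile_load \<mu> s' j = x" by blast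
    show "x = profile_load \<mu> s j"
      using balanced_unique[OF _ balanced_consumer_equilibrium[OF s'(1) assms]
          balanced_consumer_equilibrium[OF s assms] that] s'(2)
      by (simp add: producers_def)
  qed (use s in blast)
  then show ?thesis
    using balanced_consumer_equilibrium[OF s assms]
    unfolding balanced_def by (smt (verit) Collect_cong mem_Collect_eq sum.cong)
qed

section \<open>Convergence\<close>

text \<open>Each index in \<open>D\<close> from \<open>N\<close> on consumes \<open>e\<close> of the
  finite room \<open>b - f N\<close>. The potential is a sum of truncated sums in one application,
  the number of producers of maximal load in the other.\<close>

lemma finite_increase_set:
  fixes f :: "nat \<Rightarrow> real"
  assumes "0 < e" "\<And>i. N \<le> i \<Longrightarrow> f i \<le> f (Suc i)" "\<And>i. N \<le> i \<Longrightarrow> f i \<le> b"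
    and "\<And>i. N \<le> i \<Longrightarrow> i \<in> D \<Longrightarrow> f i + e \<le> f (Suc i)"
  shows "finite D"
proof (rule ccontr)
  assume "infinite D"
  then have inf: "infinite (D \<inter> {N..})"
    using finite_Un[of "D \<inter> {N..}" "{..<N}"] finite_subset[of D "D \<inter> {N..} \<union> {..<N}"] by force
  have le: "f N + e * card (D \<inter> {N..<N + m}) \<le> f (N + m)" for m
  proof (induction m)
    case (Suc m)
    have "D \<inter> {N..<N + Suc m} = (if N + m \<in> D then insert (N + m) else id) (D \<inter> {N..<N + m})"
      by (auto simp: less_Suc_eq)
    then show ?case
      using Suc assms(2)[of "N + m"] assms(4)[of "N + m"] by (auto simp: algebra_simps)
  qed simp
  obtain K :: nat where K: "(b - f N) / e < K" using reals_Archimedean2 by blast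
  obtain F where F: "F \<subseteq> D \<inter> {N..}" "finite F" "card F = K"
    using infinite_arbitrarily_large[OF inf] by blast
  define m where "m = Suc (Max (insert 0 F))"
  have "x < m" if "x \<in> F" for x using F(2) that by (simp add: m_def less_Suc_eq_le)
  then have "F \<subseteq> D \<inter> {N..<N + m}" using F(1) by fastforce
  then have "K \<le> card (D \<inter> {N..<N + m})" using F(3) by (auto intro: card_mono)
  then have "e * K \<le> e * card (D \<inter> {N..<N + m})" using assms(1) by simp
  then have "f N + e * K \<le> b" using le[of m] assms(3)[of "N + m"] by linarith
  then show False using K assms(1) by (simp add: field_simps)
qed

text \<open>Rounding up to the grid of multiples of \<open>e\<close>; the bound on \<open>g\<close>
  lets a finite grid suffice for bounded \<open>r\<close>.\<close>

lemma grid_point: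
  fixes r e :: real
  assumes "0 \<le> r" "0 < e"
  obtains g :: nat where "r \<le> g * e" "g * e < r + e" "g \<le> nat \<lceil>r / e\<rceil>"
proof
  let ?g = "nat \<lceil>r / e\<rceil>"
  have g: "real ?g = of_int \<lceil>r / e\<rceil>" using assms by simp
  show "r \<le> ?g * e"
    unfolding g by (rule pos_divide_le_eq[THEN iffD1, OF assms(2) le_of_int_ceiling])
  show "?g * e < r + e"
    unfolding g using ceiling_correct[of "r / e"] assms(2) by (simp add: field_simps)
qed simp

lemma finite_producers: "finite (\<P> n)"
  by (simp add: producers_def)

context
  fixes n :: nat and \<mu> :: "real measure"
  assumes \<mu>: "measure_on_types \<mu>" "finite_measure \<mu>"
begin

section \<open>Moves of a single producer\<close>

lemma balanced_load': "balanced (\<P> n) (upper_mass \<mu>) t (load n \<mu> t)"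
  by (rule balanced_load[OF \<mu>])

lemma upper_mass_nonpos: "y \<le> 0 \<Longrightarrow> upper_mass \<mu> y = upper_mass \<mu> 0"
  unfolding upper_mass_def space_measure_on_types[OF \<mu>(1)] by (rule arg_cong[of _ _ "measure \<mu>"]) auto

lemma upper_mass_two: "upper_mass \<mu> 2 = 0"
  unfolding upper_mass_def space_measure_on_types[OF \<mu>(1)]
  by (rule trans[OF arg_cong[of _ "{}" "measure \<mu>"]]) auto

lemma upper_mass_zero_pos:
  assumes "emeasure \<mu> \<T> > 0"
  shows "0 < upper_mass \<mu> 0"
proof -
  interpret finite_measure \<mu> by (rule \<mu>(2))
  have "{d \<in> space \<mu>. 0 \<le> d} = \<T>" by (auto simp: types_def space_measure_on_types[OF \<mu>(1)])
  then show ?thesis using assms by (simp add: upper_mass_def emeasure_eq_measure)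
qed

lemma load_own_antimono:
  assumes "j \<in> \<P> n" "x \<le> y"
  shows "load n \<mu> (t(j := y)) j \<le> load n \<mu> (t(j := x)) j"
  using balanced_own_antimono[OF finite_producers balanced_load', of "t(j := y)" j x] balanced_load' assms
  by simp

lemma load_same_own:
  assumes "j \<in> \<P> n" "x \<le> y" "load n \<mu> (t(j := x)) j = load n \<mu> (t(j := y)) j" "k \<in> \<P> n"
  shows "load n \<mu> (t(j := y)) k = load n \<mu> (t(j := x)) k"
  using balanced_same_own_load[OF finite_producers balanced_load', of "t(j := y)" j x] balanced_load' assms
  by simp

text \<open>Raising the threshold cannot raise the own load, so if it is no loss it keeps the own
  load and with it all loads. Under fine preferences a lower threshold must be paid for by a strict
  gain of load.\<close>

lemma weakly_prefers_cases:
  assumes "j \<in> \<P> n" "weakly_prefers n \<mu> j (t(j := x)) t"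
  obtains (down) "x \<le> t j" "load n \<mu> t j < load n \<mu> (t(j := x)) j"
  | (up) "t j \<le> x" "\<And>k. k \<in> \<P> n \<Longrightarrow> load n \<mu> (t(j := x)) k = load n \<mu> t k"
proof (cases "t j \<le> x")
  case True
  then have "load n \<mu> (t(j := x)) j = load n \<mu> t j"
    using load_own_antimono[OF assms(1) True, of t] assms(2)
    by (auto simp: weakly_prefers_def strictly_prefers_def)
  then have "\<And>k. k \<in> \<P> n \<Longrightarrow> load n \<mu> (t(j := x)) k = load n \<mu> t k"
    using load_same_own[OF assms(1) True, of t] by simp
  then show ?thesis using up True by blast
next
  case False
  then show ?thesis
    using assms(2) down by (auto simp: weakly_prefers_def strictly_prefers_def)
qed

lemma sum_load_le:
  assumes "t \<in> profiles n"
  shows "(\<Sum>k\<in>\<P> n. load n \<mu> t k) \<le> upper_mass \<mu> 0"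
proof -
  have "{k \<in> \<P> n. 0 \<le> t k} = \<P> n" using assms by (auto simp: profiles_def types_def PiE_iff)
  then show ?thesis using balanced_sum_le[OF balanced_load', of t 0] by simp
qed

text \<open>At threshold 0 producer \<open>j\<close> is open to all types, so its load is maximal
  and everybody is served. A best response has the same own load as 0: no less by optimality, no
  more by antitonicity. Hence it leads to the same loads.\<close>

lemma
  assumes "j \<in> \<P> n" "t \<in> profiles n" "best_response n \<mu> j t x"
  shows best_response_max_load: "k \<in> \<P> n \<Longrightarrow> load n \<mu> (t(j := x)) k \<le> load n \<mu> (t(j := x)) j"
    and best_response_total: "(\<Sum>k\<in>\<P> n. load n \<mu> (t(j := x)) k) = upper_mass \<mu> 0"
proof -
  have "0 \<le> x" using assms(3) by (simp add: best_response_def types_def)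
  moreover have "weakly_prefers n \<mu> j (t(j := x)) (t(j := 0))"
    using assms(3) by (simp add: best_response_def types_def)
  then have "load n \<mu> (t(j := x)) j \<ge> load n \<mu> (t(j := 0)) j"
    by (simp add: weakly_prefers_def strictly_prefers_def)
  ultimately have same: "load n \<mu> (t(j := x)) k = load n \<mu> (t(j := 0)) k" if "k \<in> \<P> n" for k
    using load_same_own[OF assms(1) _ _ that] load_own_antimono[OF assms(1)] by (simp add: order_antisym)
  have max0: "load n \<mu> (t(j := 0)) k \<le> load n \<mu> (t(j := 0)) j" if "k \<in> \<P> n" for k
    using assms(2) that by (intro balanced_antimono[OF balanced_load' assms(1) that])
      (auto simp: profiles_def types_def PiE_iff)
  then show "k \<in> \<P> n \<Longrightarrow> load n \<mu> (t(j := x)) k \<le> load n \<mu> (t(j := x)) j"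
    using same assms(1) by simp
  obtain y where y: "{k \<in> \<P> n. load n \<mu> (t(j := 0)) k \<le> load n \<mu> (t(j := 0)) j} = {k \<in> \<P> n. y \<le> (t(j := 0)) k}"
    "(\<Sum>k | k \<in> \<P> n \<and> load n \<mu> (t(j := 0)) k \<le> load n \<mu> (t(j := 0)) j. load n \<mu> (t(j := 0)) k) = upper_mass \<mu> y"
    using balanced_level[OF balanced_load'] .
  have "{k \<in> \<P> n. load n \<mu> (t(j := 0)) k \<le> load n \<mu> (t(j := 0)) j} = \<P> n" using max0 by blast
  moreover have "y \<le> 0" using Collect_conj_eqD[OF y(1) assms(1)] by simp
  ultimately have "(\<Sum>k\<in>\<P> n. load n \<mu> (t(j := 0)) k) = upper_mass \<mu> 0"
    using y(2) upper_mass_nonpos[of y] by simp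
  then show "(\<Sum>k\<in>\<P> n. load n \<mu> (t(j := x)) k) = upper_mass \<mu> 0"
    using same by simp
qed

text \<open>Equal loads that serve everyone stay balanced when thresholds fall: the sets above a cut
  only shrink while \<open>c\<close> and \<open>upper_mass\<close> stay the same. Uniqueness then
  identifies them.\<close>

lemma load_const_lower:
  assumes "u \<in> profiles n" "v \<in> profiles n" "\<And>k. k \<in> \<P> n \<Longrightarrow> u k \<le> v k"
    and "\<And>k. k \<in> \<P> n \<Longrightarrow> load n \<mu> v k = c" "(\<Sum>k\<in>\<P> n. load n \<mu> v k) = upper_mass \<mu> 0"
    and "j \<in> \<P> n"
  shows "load n \<mu> u j = c"
proof -
  have u01: "0 \<le> u k" "u k < 2" if "k \<in> \<P> n" for k
    using assms(1) that by (force simp: profiles_def types_def PiE_iff)+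
  have c: "0 \<le> c" using assms(4,6) balanced_nonneg[OF balanced_load'] by metis
  have "c * card {k \<in> \<P> n. y \<le> u k} \<le> upper_mass \<mu> y" for y
  proof -
    have "c * card {k \<in> \<P> n. y \<le> u k} \<le> c * card {k \<in> \<P> n. y \<le> v k}"
      using c assms(3) finite_producers
      by (intro mult_left_mono of_nat_mono card_mono) (auto intro: order_trans)
    also have "\<dots> = (\<Sum>k | k \<in> \<P> n \<and> y \<le> v k. load n \<mu> v k)"
      using assms(4) by (simp add: mult.commute)
    also have "\<dots> \<le> upper_mass \<mu> y" by (rule balanced_sum_le[OF balanced_load'])
    finally show ?thesis .
  qed
  then have "balanced (\<P> n) (upper_mass \<mu>) u (\<lambda>_. c)"
    using u01 c assms(4,5) upper_mass_two by (intro balanced_const[where ?y1.0 = 2]) (auto simp: mult.commute)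
  then show ?thesis using balanced_unique[OF finite_producers balanced_load' _ assms(6)] by metis
qed

end

theorem corollary4p37:
  fixes n :: nat and \<mu> :: "real measure" and \<delta> :: real
    and t :: "nat \<Rightarrow> nat \<Rightarrow> real" and P :: "nat \<Rightarrow> nat set"
  assumes "n \<ge> 1"
    and "measure_on_types \<mu>" and "finite_measure \<mu>" and "emeasure \<mu> \<T> > 0"
    and "\<delta> > 0"
    and "better_response_dynamic \<delta> n \<mu> t P" and "sequential P"
  shows "\<exists>N. producer_equilibrium n \<mu> (t N) \<and> (\<forall>i\<ge>N. t i = t N)"
proof -
  note \<mu> = assms(2,3)
  note fin = finite_producers[of n] and bal = balanced_load[OF \<mu>, where n = n]
  let ?M = "upper_mass \<mu> 0"
  have M: "0 < ?M" using upper_mass_zero_pos[OF \<mu> assms(4)] .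

  \<comment> \<open>Single steps of the dynamic\<close>
  have dyn: "weakly_better_response_dynamic n \<mu> t P"
    using assms(6) by (simp add: better_response_dynamic_def)
  then have sched: "schedule n P" and prof: "t i \<in> profiles n" for i
    by (auto simp: weakly_better_response_dynamic_def)
  define p where "p i = the_elem (P i)" for i
  have P: "P i = {p i}" for i
    using assms(7) unfolding sequential_def p_def by (metis card_1_singletonE the_elem_eq)
  have p_prod: "p i \<in> \<P> n" for i using sched P[of i] unfolding schedule_def by blast
  have again: "\<exists>i\<ge>N. p i = k" if "k \<in> \<P> n" for k N
  proof -
    have "infinite {i. p i = k}" using sched that P unfolding schedule_def by (simp add: eq_commute)
    then show ?thesis unfolding infinite_nat_iff_unbounded_le by blast
  qed
  have step: "t (Suc i) = (t i)(p i := t (Suc i) (p i))" for i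
  proof
    fix k
    show "t (Suc i) k = ((t i)(p i := t (Suc i) (p i))) k"
    proof (cases "k \<in> \<P> n")
      case True
      then show ?thesis using dyn P[of i] by (auto simp: weakly_better_response_dynamic_def)
    next
      case False
      then show ?thesis using prof[of i] prof[of "Suc i"] by (auto simp: profiles_def PiE_iff extensional_def)
    qed
  qed
  have pref: "weakly_prefers n \<mu> (p i) ((t i)(p i := t (Suc i) (p i))) (t i)" for i
    using dyn P[of i] by (auto simp: weakly_better_response_dynamic_def)
  have step_cases: "(t (Suc i) (p i) \<le> t i (p i) \<and> load n \<mu> (t i) (p i) < load n \<mu> (t (Suc i)) (p i)) \<or>
      (t i (p i) \<le> t (Suc i) (p i) \<and> (\<forall>k\<in>\<P> n. load n \<mu> (t (Suc i)) k = load n \<mu> (t i) k))" for i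
    using weakly_prefers_cases[OF \<mu> p_prod pref, of i] step[of i] by metis
  have bal_step: "balanced (\<P> n) (upper_mass \<mu>) ((t i)(p i := t (Suc i) (p i))) (load n \<mu> (t (Suc i)))" for i
    using bal[of "t (Suc i)"] step[of i] by simp

  \<comment> \<open>
    A step in \<open>D\<close> raises \<open>cap i g\<close> by at least \<open>\<delta> / 4\<close> for a grid point \<open>g * \<delta> / 2\<close>
    lying between the old and the new load with some margin.
  \<close>
  define D where "D = {i. load n \<mu> (t i) (p i) + \<delta> \<le> load n \<mu> (t (Suc i)) (p i)}"
  \<comment> \<open>No load exceeds \<open>?M\<close>, so this bounds the grid index of every load
    and keeps the potential a finite sum.\<close>
  define K where "K = nat \<lceil>(?M + \<delta> / 4) / (\<delta> / 2)\<rceil>"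
  define cap where "cap i g = (\<Sum>k\<in>\<P> n. min (load n \<mu> (t i) k) (real g * (\<delta> / 2)))" for i g
  have cap_mono: "cap i g \<le> cap (Suc i) g" for i g
    using step_cases[of i]
  proof (elim disjE conjE)
    assume "t (Suc i) (p i) \<le> t i (p i)"
    then show ?thesis
      unfolding cap_def using assms(5)
      by (intro balanced_sum_min_mono[OF fin bal bal_step]) auto
  qed (simp add: cap_def)
  have "finite D"
  proof (rule finite_increase_set[where f = "\<lambda>i. \<Sum>g\<le>K. cap i g" and e = "\<delta> / 4" and b = "real (Suc K) * ?M" and N = 0])
    show "(\<Sum>g\<le>K. cap i g) \<le> (\<Sum>g\<le>K. cap (Suc i) g)" for i by (intro sum_mono cap_mono)
    have "cap i g \<le> ?M" for i g
    proof -
      have "cap i g \<le> (\<Sum>k\<in>\<P> n. load n \<mu> (t i) k)" unfolding cap_def by (intro sum_mono) simp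
      then show ?thesis using sum_load_le[OF \<mu> prof, of i] by simp
    qed
    then have "(\<Sum>g\<le>K. cap i g) \<le> (\<Sum>g\<le>K. ?M)" for i by (intro sum_mono)
    then show "(\<Sum>g\<le>K. cap i g) \<le> real (Suc K) * ?M" for i by simp
    show "(\<Sum>g\<le>K. cap i g) + \<delta> / 4 \<le> (\<Sum>g\<le>K. cap (Suc i) g)" if "i \<in> D" for i
    proof -
      let ?l = "load n \<mu> (t i) (p i)"
      have gain: "?l + \<delta> \<le> load n \<mu> (t (Suc i)) (p i)" using that by (simp add: D_def)
      then have down: "t (Suc i) (p i) \<le> t i (p i)" using step_cases[of i] p_prod[of i] assms(5) by auto
      have l0: "0 \<le> ?l" using balanced_nonneg[OF bal p_prod] .
      have "?l \<le> (\<Sum>k\<in>\<P> n. load n \<mu> (t i) k)"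
        using balanced_nonneg[OF bal] fin by (intro member_le_sum[OF p_prod]) auto
      then have lM: "?l \<le> ?M" using sum_load_le[OF \<mu> prof, of i] by simp
      \<comment> \<open>There is a margin of \<delta>/4 on both sides: the grid point is at least
        \<delta>/4 and less than 3\<delta>/4 above the old load, hence below the new load.\<close>
      obtain g :: nat where g: "?l + \<delta> / 4 \<le> g * (\<delta> / 2)" "g * (\<delta> / 2) < ?l + \<delta> / 4 + \<delta> / 2"
        "g \<le> nat \<lceil>(?l + \<delta> / 4) / (\<delta> / 2)\<rceil>"
        using grid_point[of "?l + \<delta> / 4" "\<delta> / 2"] l0 assms(5) by auto
      have "nat \<lceil>(?l + \<delta> / 4) / (\<delta> / 2)\<rceil> \<le> K"
        unfolding K_def using lM assms(5) by (intro nat_mono ceiling_mono divide_right_mono) auto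
      with g(3) have gK: "g \<le> K" by (rule order_trans)
      have "cap i g + \<delta> / 4 \<le> cap (Suc i) g"
        unfolding cap_def
        by (rule balanced_sum_min_gain[OF fin bal bal_step p_prod down g(1)]) (use g(2) gain assms(5) in linarith)
      moreover have "(\<Sum>h\<in>{..K} - {g}. cap i h) \<le> (\<Sum>h\<in>{..K} - {g}. cap (Suc i) h)"
        by (intro sum_mono cap_mono)
      ultimately show ?thesis using gK by (simp add: sum.remove[of "{..K}" g])
    qed
  qed (use assms(5) in auto)
  then obtain N1 where N1: "\<And>i. N1 \<le> i \<Longrightarrow> i \<notin> D"
    unfolding finite_nat_set_iff_bounded by (meson linorder_not_less)
  have br: "best_response n \<mu> (p i) (t i) (t (Suc i) (p i))" if "N1 \<le> i" for i
  proof -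
    have "best_response n \<mu> (p i) (t i) (t (Suc i) (p i)) \<or>
        load n \<mu> (t i) (p i) + \<delta> \<le> load n \<mu> ((t i)(p i := t (Suc i) (p i))) (p i)"
      using assms(6) P[of i] unfolding better_response_dynamic_def by blast
    then show ?thesis using N1[OF that] unfolding step[of i, symmetric] by (simp add: D_def)
  qed
  have max_load: "load n \<mu> (t (Suc i)) k \<le> load n \<mu> (t (Suc i)) (p i)" if "N1 \<le> i" "k \<in> \<P> n" for i k
    using best_response_max_load[OF \<mu> p_prod prof br[OF that(1)] that(2)] unfolding step[of i, symmetric] .
  \<comment> \<open>Off by one: the step at \<open>N1\<close> is the first known best response, and
    its effect shows in the profile at \<open>Suc N1\<close>.\<close>
  have total: "(\<Sum>k\<in>\<P> n. load n \<mu> (t i) k) = ?M" if "Suc N1 \<le> i" for i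
  proof -
    from that obtain i' where "i = Suc i'" "N1 \<le> i'" by (cases i) auto
    then show ?thesis using best_response_total[OF \<mu> p_prod prof br, of i'] unfolding step[of i', symmetric] by simp
  qed

  \<comment> \<open>Finitely many strict gains of load\<close>
  define E where "E = {i. load n \<mu> (t i) (p i) < load n \<mu> (t (Suc i)) (p i)}"
  define H where "H i = Max (load n \<mu> (t i) ` \<P> n)" for i
  define top where "top i = card {k \<in> \<P> n. load n \<mu> (t i) k = H i}" for i
  have H: "load n \<mu> (t i) k \<le> H i" if "k \<in> \<P> n" for i k
    unfolding H_def using fin that by simp
  have H_Suc: "H (Suc i) = load n \<mu> (t (Suc i)) (p i)" if "N1 \<le> i" for i
    unfolding H_def using fin p_prod max_load[OF that] by (intro Max_eqI) auto
  have top_less: "top i < top (Suc i)" if "Suc N1 \<le> i" "i \<in> E" for i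
  proof -
    have "H i > 0"
    proof (rule ccontr)
      assume "\<not> 0 < H i"
      then have "(\<Sum>k\<in>\<P> n. load n \<mu> (t i) k) \<le> 0" using H[of _ i] by (intro sum_nonpos) force
      then show False using total[OF that(1)] M by simp
    qed
    moreover have "t (Suc i) (p i) \<le> t i (p i)" using step_cases[of i] that(2) p_prod[of i] by (auto simp: E_def)
    ultimately show ?thesis
      unfolding top_def H_Suc[OF Suc_leD[OF that(1)]]
      using that(2) total[OF that(1)] total[of "Suc i"] that(1) max_load[of i] H[of _ i]
      by (intro balanced_card_max_less[OF fin bal bal_step p_prod]) (auto simp: E_def)
  qed
  have same: "load n \<mu> (t (Suc i)) k = load n \<mu> (t i) k" if "i \<notin> E" "k \<in> \<P> n" for i k
    using step_cases[of i] that by (auto simp: E_def)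
  have top_le: "top i \<le> top (Suc i)" if "Suc N1 \<le> i" for i
  proof (cases "i \<in> E")
    case True
    then show ?thesis using top_less[OF that] by simp
  next
    case False
    then have "load n \<mu> (t (Suc i)) ` \<P> n = load n \<mu> (t i) ` \<P> n" using same by auto
    then show ?thesis using same[OF False] by (simp add: top_def H_def cong: conj_cong)
  qed
  have "finite E"
  proof (rule finite_increase_set[where f = "\<lambda>i. real (top i)" and e = 1 and b = "card (\<P> n)" and N = "Suc N1"])
    show "real (top i) \<le> card (\<P> n)" for i
      unfolding top_def using fin by (intro of_nat_mono card_mono) auto
    show "real (top i) + 1 \<le> real (top (Suc i))" if "Suc N1 \<le> i" "i \<in> E" for i
      using top_less[OF that] by simp
  qed (use top_le in auto)
  then obtain N2 where N2: "\<And>i. N2 \<le> i \<Longrightarrow> i \<notin> E"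
    unfolding finite_nat_set_iff_bounded by (meson linorder_not_less)

  \<comment> \<open>Equal loads and rising thresholds\<close>
  define N3 where "N3 = max (Suc N1) N2"
  have N3: "Suc N1 \<le> i" "N1 \<le> i" "i \<notin> E" if "N3 \<le> i" for i using that N2 by (auto simp: N3_def)
  have const: "load n \<mu> (t i) k = load n \<mu> (t N3) k" if "N3 \<le> i" "k \<in> \<P> n" for i k
    using that(1) by (induction i rule: dec_induct) (auto simp: same[OF N3(3) that(2)])
  \<comment> \<open>Each producer moves again, and its load is then maximal; as the loads no longer
    change, all are maximal.\<close>
  have equal: "load n \<mu> (t N3) k \<le> load n \<mu> (t N3) j" if "k \<in> \<P> n" "j \<in> \<P> n" for k j
  proof -
    from again[OF that(2)] obtain i where "N3 \<le> i" "p i = j" by blast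
    then show ?thesis
      using max_load[OF N3(2), of i k] const[of "Suc i"] that by simp
  qed
  define c where "c = load n \<mu> (t N3) (p 0)"
  have load_c: "load n \<mu> (t i) k = c" if "N3 \<le> i" "k \<in> \<P> n" for i k
    using const[OF that] equal[of k "p 0"] equal[of "p 0" k] that(2) p_prod[of 0] by (simp add: c_def)
  have t_Suc: "t i k \<le> t (Suc i) k" if "N3 \<le> i" for i k
  proof (cases "k = p i")
    case True
    then show ?thesis using step_cases[of i] N3(3)[OF that] by (auto simp: E_def)
  next
    case False
    then show ?thesis using fun_cong[OF step[of i], of k] by simp
  qed
  have t_mono: "t i k \<le> t i' k" if "N3 \<le> i" "i \<le> i'" for i i' k
    using that(2,1) by (induction i' rule: dec_induct) (auto intro: order_trans t_Suc)
  \<comment> \<open>\<open>?u\<close> lets \<open>p i\<close> take its later threshold already at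
    \<open>i\<close>. It lies below the later profile, which serves everyone with equal loads, so
    \<open>p i\<close> has load \<open>c\<close> there as well; a best response at \<open>i\<close>
    is then no lower than that threshold.\<close>
  have settled: "t (Suc i') (p i) \<le> t (Suc i) (p i)" if i: "N3 \<le> i" "i < i'" for i i'
  proof -
    let ?u = "(t i)(p i := t (Suc i') (p i))"
    have u: "?u \<in> profiles n"
      using prof[of i] prof[of "Suc i'"] p_prod[of i] by (auto simp: profiles_def PiE_iff extensional_def)
    have "load n \<mu> ?u (p i) = c"
    proof (rule load_const_lower[OF \<mu> u prof[of "Suc i'"] _ _ _ p_prod])
      show "?u k \<le> t (Suc i') k" for k using t_mono[of i "Suc i'" k] i by simp
      show "load n \<mu> (t (Suc i')) k = c" if "k \<in> \<P> n" for k using load_c[OF _ that, of "Suc i'"] i by simp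
      show "(\<Sum>k\<in>\<P> n. load n \<mu> (t (Suc i')) k) = ?M" using total[of "Suc i'"] N3(2)[OF i(1)] i(2) by simp
    qed
    moreover have "load n \<mu> (t (Suc i)) (p i) = c" using load_c[of "Suc i"] i(1) p_prod by simp
    moreover have "t (Suc i') (p i) \<in> \<T>" using prof[of "Suc i'"] p_prod[of i] by (auto simp: profiles_def)
    with br[OF N3(2)[OF i(1)]] have "weakly_prefers n \<mu> (p i) ((t i)(p i := t (Suc i) (p i))) ?u"
      unfolding best_response_def by blast
    then have "weakly_prefers n \<mu> (p i) (t (Suc i)) ?u" unfolding step[of i, symmetric] .
    ultimately show ?thesis by (simp add: weakly_prefers_def strictly_prefers_def)
  qed

  \<comment> \<open>The limit profile\<close>
  have "\<forall>k\<in>\<P> n. \<exists>i. N3 \<le> i \<and> p i = k" using again by simp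
  from bchoice[OF this] obtain f where f: "\<forall>k\<in>\<P> n. N3 \<le> f k \<and> p (f k) = k" ..
  \<comment> \<open>By \<open>N\<close> every producer has moved since \<open>N3\<close>; the
    successor makes \<open>f k\<close> strictly smaller, as \<open>settled\<close> requires.\<close>
  define N where "N = Suc (Max (insert N3 (f ` \<P> n)))"
  have N_gt: "f k < N" if "k \<in> \<P> n" for k
    unfolding N_def less_Suc_eq_le using that fin by (intro Max_ge) auto
  have N_ge: "N3 \<le> N" unfolding N_def using fin by (intro le_SucI Max_ge) auto
  have fixed: "t (Suc i) = t i" if "N \<le> i" for i
  proof -
    let ?j = "p i"
    have fj: "N3 \<le> f ?j" "p (f ?j) = ?j" "f ?j < i" using f p_prod[of i] N_gt[OF p_prod, of i] that by auto
    have "t (Suc i) ?j \<le> t (Suc (f ?j)) ?j" using settled[OF fj(1,3)] fj(2) by simp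
    also have "\<dots> \<le> t i ?j" using t_mono[of "Suc (f ?j)" i] fj by simp
    finally have "t (Suc i) ?j = t i ?j" using t_Suc[of i ?j] that N_ge by (simp add: order_antisym)
    then show ?thesis by (subst step) simp
  qed
  have stable: "t i = t N" if "N \<le> i" for i
    using that by (induction i rule: dec_induct) (auto simp: fixed)
  have "producer_equilibrium n \<mu> (t N)"
    unfolding producer_equilibrium_def
  proof (intro conjI ballI)
    fix j y assume j: "j \<in> \<P> n" and y: "y \<in> \<T>"
    \<comment> \<open>When \<open>j\<close> moves after \<open>N\<close> nothing changes, so its
      current threshold is a best response.\<close>
    obtain i where i: "N \<le> i" "p i = j" using again[OF j] by blast
    have "best_response n \<mu> j (t N) (t N j)"
      using br[of i] i N3(2)[of i] N_ge stable[of i] stable[of "Suc i"] by simp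
    then show "\<not> strictly_prefers n \<mu> j ((t N)(j := y)) (t N)"
      using y by (simp add: best_response_def weakly_prefers_def)
  qed (rule prof)
  then show ?thesis using stable by blast
qed

end
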